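(* Let $\Pi$ be a Gibbs partition with parameters $(\alpha,V)$, let $n,m\ge1$, and condition on the restriction of $\Pi$ to $[n]$ being a given partition into $j$ blocks with sizes $(n_1,\dots,n_j)$. For $i=1,\dots,j$ let $M_{i,m}$ be the number of integers among $n+1,\dots,n+m$ that fall in the $i$-th old block, and for $l\in\{1,\dots,n+m\}$ let $O^{(n)}_{l,m}=\sum_{i:\,n_i\le l}1\{n_i+M_{i,m}=l\}$. Then, conditionally on the given partition of $[n]$, for every integer $y\ge0$, $$\mathbb{P}(O^{(n)}_{l,m}=y)=\sum_{r\ge0}\frac{(-1)^r(r+y)!}{y!\,r!}\frac1{V_{n,j}}\sum_{\{\xi_1,\dots,\xi_{r+y}\}}\frac{m!\,\prod_{i=1}^{r+y}(n_{\xi_i}-\alpha)_{l-n_{\xi_i}}}{\prod_{i=1}^{r+y}(l-n_{\xi_i})!\,(m-rl-yl+\sum_{i=1}^{r+y}n_{\xi_i})!}$$ $$\times\sum_{k=0}^{m-rl-yl+\sum_{i=1}^{r+y}n_{\xi_i}}V_{n+m,j+k}\,S^{-1,-\alpha,-(n-(j-r-y)\alpha-\sum_{i=1}^{r+y}n_{\xi_i})}_{m-rl-yl+\sum_{i=1}^{r+y}n_{\xi_i},\;k},$$ where the middle sum is over all $(r+y)$-element subsets $\{\xi_1,\dots,\xi_{r+y}\}$ of $\{i\in\{1,\dots,j\}:n_i\le l\}$ with $m-rl-yl+\sum_{i=1}^{r+y}n_{\xi_i}\ge0$ (so that only finitely many $r$ contribute). Moreover, $$\mathbb{E}(O^{(n)}_{l,m})=\sum_{i:\,n_i\le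 l}\mathbb{P}(M_{i,m}=l-n_i\mid n_1,\dots,n_j)=\sum_{i:\,n_i\le l}\binom m{l-n_i}\frac{(n_i-\alpha)_{l-n_i}}{V_{n,j}}\sum_{k=0}^{m-l+n_i}V_{n+m,j+k}\,S^{-1,-\alpha,-(n-j\alpha+\alpha-n_i)}_{m-l+n_i,\,k},$$ the latter being the Bayesian nonparametric estimator under quadratic loss of the number of old species represented $l$ times.
   Context: Notation: $(x)_n=x(x+1)\cdots(x+n-1)$ ($(x)_0=1$). Terms with $\binom{m}{l-n_i}=0$ (i.e. $l-n_i>m$) are zero. The Bayesian estimator under quadratic loss is the conditional expectation given the observed partition of $[n]$ (blocks are "species"). Gibbs partition with parameters $(\alpha,V)$: $\alpha\in(-\infty,1)$ and $V=(V_{n,k})_{1\le k\le n}$ are nonnegative weights with $V_{1,1}=1$ and $V_{n,k}=(n-k\alpha)V_{n+1,k}+V_{n+1,k+1}$; $\Pi$ is the exchangeable random partition of the positive integers such that for every $n$ and every partition $\{A_1,\dots,A_k\}$ of $[n]=\{1,\dots,n\}$, the restriction $\Pi_n$ of $\Pi$ to $[n]$ satisfies $\mathbb{P}(\Pi_n=\{A_1,\dots,A_k\})=V_{n,k}\prod_{i=1}^k(1-\alpha)_{|A_i|-1}$. Conditional setting: it is assumed $V_{n,j}>0$. Given $\Pi_n$ (with $j$ blocks of sizes $n_1,\dots,n_j$), a block of $\Pi_{n+m}$ is old if it meets $[n]$, new otherwise; the $i$-th old block is the one containing the $i$-th block of $\Pi_n$. The conditional probability that $\Pi_{n+m}$ equals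 a specified partition extending $\Pi_n$, in which the old blocks gain $m_1,\dots,m_j\ge0$ elements and there are $k$ new blocks of sizes $s_1,\dots,s_k\ge1$, is $\frac{V_{n+m,j+k}}{V_{n,j}}\prod_{i=1}^j(n_i-\alpha)_{m_i}\prod_{i=1}^k(1-\alpha)_{s_i-1}$. Generalized central Stirling numbers: $S^{-1,-\alpha}_{n,k}=\frac{n!}{k!}\sum_{(n_1,\dots,n_k)}\prod_{j=1}^k\frac{(1-\alpha)_{n_j-1}}{n_j!}$, the sum being over compositions of $n$ into $k$ positive parts ($S_{0,0}^{-1,-\alpha}=1$, $S_{n,0}^{-1,-\alpha}=0$ for $n\ge1$, $S_{n,k}^{-1,-\alpha}=0$ for $k>n$). Generalized non-central Stirling numbers: $S^{-1,-\alpha,\gamma}_{n,k}=\sum_{s=k}^n\binom ns S^{-1,-\alpha}_{s,k}(-\gamma)_{n-s}$. *)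

theory Defs
  imports "HOL-Probability.Probability" "HOL-Combinatorics.Permutations"
begin

definition restrict_partition :: "nat \<Rightarrow> nat set set \<Rightarrow> nat set set" where
  "restrict_partition n P = (\<lambda>B. B \<inter> {1..n}) ` P - {{}}"

text \<open>
  A random partition is measurable with respect to the \<open>\<sigma>\<close>-algebra generated by its
  restrictions to the finite sets \<open>{1..n}\<close>, each of which takes only finitely many values.
  Exchangeability is invariance of the law of every such restriction under the permutations
  of \<open>{1..n}\<close>.
\<close>

locale exchangeable_random_partition = prob_space M for M :: "'a measure" +
  fixes \<pi> :: "'a \<Rightarrow> nat set set"
  assumes partition: "\<And>\<omega>. \<omega> \<in> space M \<Longrightarrow> partition_on {1..} (\<pi> \<omega>)"
    and measurable_restrict:
      "\<And>n. (\<lambda>\<omega>. restrict_partition n (\<pi> \<omega>)) \<in> measurable M (count_space UNIV)"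
    and exchangeable:
      "\<And>n \<sigma>. \<sigma> permutes {1..n} \<Longrightarrow>
        distr M (count_space UNIV) (\<lambda>\<omega>. (`) \<sigma> ` restrict_partition n (\<pi> \<omega>)) =
        distr M (count_space UNIV) (\<lambda>\<omega>. restrict_partition n (\<pi> \<omega>))"

text \<open>Only the values \<open>V n k\<close> with \<open>1 \<le> k \<le> n\<close> are meaningful.\<close>

definition gibbs_weights :: "real \<Rightarrow> (nat \<Rightarrow> nat \<Rightarrow> real) \<Rightarrow> bool" where
  "gibbs_weights \<alpha> V \<longleftrightarrow>
     (\<forall>n k. 1 \<le> k \<and> k \<le> n \<longrightarrow> V n k \<ge> 0) \<and>
     V 1 1 = 1 \<and>
     (\<forall>n k. 1 \<le> k \<and> k \<le> n \<longrightarrow>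
        V n k = (real n - real k * \<alpha>) * V (n + 1) k + V (n + 1) (k + 1))"

locale gibbs_partition = exchangeable_random_partition M \<pi>
  for M :: "'a measure" and \<alpha> :: real and V :: "nat \<Rightarrow> nat \<Rightarrow> real"
    and \<pi> :: "'a \<Rightarrow> nat set set" +
  assumes alpha_less_1: "\<alpha> < 1"
    and weights: "gibbs_weights \<alpha> V"
    and prob_restrict:
      "\<And>n Q. n \<ge> 1 \<Longrightarrow> partition_on {1..n} Q \<Longrightarrow>
        \<P>(\<omega> in M. restrict_partition n (\<pi> \<omega>) = Q) =
          V n (card Q) * (\<Prod>B\<in>Q. pochhammer (1 - \<alpha>) (card B - 1))"

text \<open>
  Here \<open>Q\<close> is a partition of \<open>{1..n + m}\<close> and \<open>B\<close> a block of its restriction to \<open>{1..n}\<close>;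
  the result is the number of elements among \<open>n + 1, \<dots>, n + m\<close> of the unique block of \<open>Q\<close>
  containing \<open>B\<close>.
\<close>

definition old_block_gain :: "nat \<Rightarrow> nat \<Rightarrow> nat set \<Rightarrow> nat set set \<Rightarrow> nat" where
  "old_block_gain n m B Q = card {x \<in> {n+1..n+m}. \<exists>C\<in>Q. B \<subseteq> C \<and> x \<in> C}"

definition old_blocks_of_size ::
    "nat \<Rightarrow> nat \<Rightarrow> nat \<Rightarrow> nat \<Rightarrow> (nat \<Rightarrow> nat set) \<Rightarrow> nat set set \<Rightarrow> nat" where
  "old_blocks_of_size n m l j A Q =
     (\<Sum>i\<in>{i \<in> {1..j}. card (A i) \<le> l}. of_bool (card (A i) + old_block_gain n m (A i) Q = l))"

text \<open>
  The same number as a function of the partition \<open>Q\<close> of \<open>{1..n + m}\<close> alone, not referring to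
  an enumeration \<open>A\<close> of the blocks of one particular observed partition of \<open>{1..n}\<close>.
\<close>

definition old_species :: "nat \<Rightarrow> nat \<Rightarrow> nat set set \<Rightarrow> nat" where
  "old_species n l Q = card {C \<in> Q. C \<inter> {1..n} \<noteq> {} \<and> card C = l}"

text \<open>
  The Bayesian estimator of \<open>f\<close> under quadratic loss: the conditional expectation given the
  observed partition of \<open>{1..n}\<close>.
\<close>

definition bayes_estimator ::
    "'a measure \<Rightarrow> ('a \<Rightarrow> nat set set) \<Rightarrow> nat \<Rightarrow> ('a \<Rightarrow> real) \<Rightarrow> 'a \<Rightarrow> real" where
  "bayes_estimator M \<pi> n f =
     real_cond_exp M
       (vimage_algebra (space M) (\<lambda>\<omega>. restrict_partition n (\<pi> \<omega>)) (count_space UNIV)) f"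

text \<open>
  The generalized central and non-central Stirling numbers \<open>S\<close> with superscripts
  \<open>-1, -\<alpha>\<close> and \<open>-1, -\<alpha>, \<gamma>\<close>.
\<close>

definition gen_stirling :: "real \<Rightarrow> nat \<Rightarrow> nat \<Rightarrow> real" where
  "gen_stirling \<alpha> n k =
     fact n / fact k *
     (\<Sum>ns | length ns = k \<and> 0 \<notin> set ns \<and> sum_list ns = n.
        \<Prod>i<k. pochhammer (1 - \<alpha>) (ns ! i - 1) / fact (ns ! i))"

definition gen_stirling_nc :: "real \<Rightarrow> real \<Rightarrow> nat \<Rightarrow> nat \<Rightarrow> real" where
  "gen_stirling_nc \<alpha> \<gamma> n k =
     (\<Sum>s=k..n. real (n choose s) * gen_stirling \<alpha> s k * pochhammer (- \<gamma>) (n - s))"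

end

theory Submission
  imports Defs "HOL-Computational_Algebra.Formal_Power_Series"
begin

text \<open>
  Summing the block weights over all partitions of \<open>{1..n + m}\<close> that extend a given partition of
  \<open>{1..n}\<close>, with the gains of some selected old blocks and the number \<open>k\<close> of new blocks
  prescribed, yields a quantity that satisfies a recursion in \<open>m\<close>: the element \<open>n + m + 1\<close>
  joins a selected block, joins any other block, or forms a new one. The proposed closed form
  satisfies the same recursion because of the triangular recurrence of the non-central Stirling
  numbers, which is read off the differential equation of their generating function. This gives
  the joint conditional law of the gains of any set of old blocks; the law of the number of old
  blocks of size \<open>l\<close> follows by inclusion-exclusion and its mean by linearity. Finally, the
  conditional expectation given a discrete observation is constant on every atom.
\<close>

subsection \<open>Generating functions of the generalized Stirling numbers\<close>

unbundle no vec_syntax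
unbundle fps_syntax

text \<open>The series of (1 - (1 - x)^\<alpha>) / \<alpha>, or of -log(1 - x) when \<alpha> = 0.
  Giving the coefficients directly covers both cases.\<close>

definition stirling_fps :: "real \<Rightarrow> real fps" where
  "stirling_fps \<alpha> = Abs_fps (\<lambda>n. if n = 0 then 0 else pochhammer (1 - \<alpha>) (n - 1) / fact n)"

text \<open>The binomial series of (1 - x)^(-c).\<close>

definition rising_fps :: "real \<Rightarrow> real fps" where
  "rising_fps c = Abs_fps (\<lambda>n. pochhammer c n / fact n)"

lemma stirling_fps_nth_Suc:
  "real (Suc n) * stirling_fps \<alpha> $ Suc n = pochhammer (1 - \<alpha>) n / fact n"
  by (simp add: stirling_fps_def del: of_nat_Suc)

text \<open>The derivative of the series P is (1 - x)^(\<alpha> - 1), and (1 - x)^\<alpha> = 1 -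
  \<alpha> P. The proof compares coefficients instead, using the ratio of consecutive ones.\<close>

lemma stirling_fps_deriv:
  "(1 - fps_X) * fps_deriv (stirling_fps \<alpha>) = 1 - fps_const \<alpha> * stirling_fps \<alpha>"
proof (rule fps_ext)
  fix n
  show "((1 - fps_X) * fps_deriv (stirling_fps \<alpha>)) $ n = (1 - fps_const \<alpha> * stirling_fps \<alpha>) $ n"
  proof (cases n)
    case (Suc k)
    have "((1 - fps_X) * fps_deriv (stirling_fps \<alpha>)) $ n =
        real (Suc (Suc k)) * stirling_fps \<alpha> $ Suc (Suc k) - real (Suc k) * stirling_fps \<alpha> $ Suc k"
      by (simp add: Suc left_diff_distrib)
    also have "\<dots> = (1 - \<alpha> + real k) * pochhammer (1 - \<alpha>) k / (real (Suc k) * fact k)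
        - real (Suc k) * (pochhammer (1 - \<alpha>) k / (real (Suc k) * fact k))"
      by (simp add: stirling_fps_nth_Suc pochhammer_Suc del: of_nat_Suc)
    \<comment> \<open>(1 - \<alpha> + k) - (k + 1) = -\<alpha>.\<close>
    also have "\<dots> = - \<alpha> * (pochhammer (1 - \<alpha>) k / (real (Suc k) * fact k))"
      unfolding times_divide_eq_right [symmetric] by (simp only: of_nat_Suc left_diff_distrib [symmetric]) simp
    finally show ?thesis
      by (simp add: Suc stirling_fps_def)
  qed (simp add: stirling_fps_def left_diff_distrib)
qed

lemma rising_fps_nth_Suc:
  "real (Suc n) * rising_fps c $ Suc n = (c + real n) * rising_fps c $ n"
  by (simp add: rising_fps_def pochhammer_Suc del: of_nat_Suc)

lemma rising_fps_deriv:
  "(1 - fps_X) * fps_deriv (rising_fps c) = fps_const c * rising_fps c"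
proof (rule fps_ext)
  fix n
  show "((1 - fps_X) * fps_deriv (rising_fps c)) $ n = (fps_const c * rising_fps c) $ n"
  proof (cases n)
    case (Suc k)
    have "((1 - fps_X) * fps_deriv (rising_fps c)) $ n =
        real (Suc n) * rising_fps c $ Suc n - real n * rising_fps c $ n"
      by (simp add: Suc left_diff_distrib)
    also have "\<dots> = c * rising_fps c $ n"
      unfolding rising_fps_nth_Suc by (simp add: algebra_simps)
    finally show ?thesis
      by simp
  qed (simp add: rising_fps_def left_diff_distrib)
qed

text \<open>A coefficient of a k-th power is a sum over all lists of length k with the given total.
  Lists with a zero entry contribute nothing because the constant term of
  \<open>stirling_fps\<close> is 0, so only compositions into positive parts remain.\<close>

lemma gen_stirling_eq_fps_nth:
  "gen_stirling \<alpha> n k = fact n / fact k * (stirling_fps \<alpha> ^ k) $ n"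
proof -
  have fin: "finite (natpermute n k)"
    by (rule natpermute_finite)
  have "(stirling_fps \<alpha> ^ k) $ n = (\<Sum>ns\<in>natpermute n k. \<Prod>i<k. stirling_fps \<alpha> $ (ns ! i))"
  proof (cases k)
    case 0
    then show ?thesis by (simp add: natpermute_0)
  next
    case (Suc h)
    then show ?thesis by (simp add: fps_power_nth atLeast0AtMost lessThan_Suc_atMost del: power_Suc)
  qed
  also have "\<dots> = (\<Sum>ns | length ns = k \<and> 0 \<notin> set ns \<and> sum_list ns = n.
        \<Prod>i<k. pochhammer (1 - \<alpha>) (ns ! i - 1) / fact (ns ! i))"
  proof (rule sum.mono_neutral_cong_right[OF fin])
    show "{ns. length ns = k \<and> 0 \<notin> set ns \<and> sum_list ns = n} \<subseteq> natpermute n k"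
      by (auto simp: natpermute_def)
    show "\<forall>ns\<in>natpermute n k - {ns. length ns = k \<and> 0 \<notin> set ns \<and> sum_list ns = n}.
            (\<Prod>i<k. stirling_fps \<alpha> $ (ns ! i)) = 0"
    proof
      fix ns assume "ns \<in> natpermute n k - {ns. length ns = k \<and> 0 \<notin> set ns \<and> sum_list ns = n}"
      then obtain i where "i < k" "ns ! i = 0"
        by (auto simp: natpermute_def in_set_conv_nth)
      then show "(\<Prod>i<k. stirling_fps \<alpha> $ (ns ! i)) = 0"
        by (intro prod_zero bexI[of _ i]) (simp_all add: stirling_fps_def)
    qed
    show "(\<Prod>i<k. stirling_fps \<alpha> $ (ns ! i)) =
            (\<Prod>i<k. pochhammer (1 - \<alpha>) (ns ! i - 1) / fact (ns ! i))"
      if "ns \<in> {ns. length ns = k \<and> 0 \<notin> set ns \<and> sum_list ns = n}" for ns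
    proof (rule prod.cong)
      fix i assume "i \<in> {..<k}"
      then have "ns ! i \<in> set ns" using that by auto
      then have "ns ! i \<noteq> 0" using that by (metis (mono_tags, lifting) mem_Collect_eq)
      then show "stirling_fps \<alpha> $ (ns ! i) = pochhammer (1 - \<alpha>) (ns ! i - 1) / fact (ns ! i)"
        by (simp add: stirling_fps_def)
    qed simp
  qed
  finally show ?thesis by (simp add: gen_stirling_def)
qed

text \<open>The defining sum is a binomial convolution, hence a product of exponential generating
  functions. It may start at s = 0 because x^k divides the k-th power of
  \<open>stirling_fps\<close>.\<close>

lemma gen_stirling_nc_eq_fps_nth:
  "gen_stirling_nc \<alpha> \<gamma> n k = fact n / fact k * (stirling_fps \<alpha> ^ k * rising_fps (- \<gamma>)) $ n"
proof -
  have zero: "(stirling_fps \<alpha> ^ k) $ s = 0" if "s < k" for s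
    using that startsby_zero_power_prefix[of "stirling_fps \<alpha>" k] by (simp add: stirling_fps_def)
  have "gen_stirling_nc \<alpha> \<gamma> n k =
      (\<Sum>s=k..n. fact n / fact k * ((stirling_fps \<alpha> ^ k) $ s * rising_fps (- \<gamma>) $ (n - s)))"
    unfolding gen_stirling_nc_def gen_stirling_eq_fps_nth
    by (intro sum.cong refl) (simp add: rising_fps_def binomial_fact mult_ac)
  also have "\<dots> = (\<Sum>s=0..n. fact n / fact k * ((stirling_fps \<alpha> ^ k) $ s * rising_fps (- \<gamma>) $ (n - s)))"
    by (rule sum.mono_neutral_left) (auto simp: zero)
  finally show ?thesis
    by (simp add: fps_mult_nth sum_distrib_left)
qed

lemma gen_stirling_nc_0: "gen_stirling_nc \<alpha> \<gamma> 0 k = of_bool (k = 0)"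
  by (cases k) (simp_all add: gen_stirling_nc_eq_fps_nth rising_fps_def stirling_fps_def)

lemma gen_stirling_nc_eq_0: "n < k \<Longrightarrow> gen_stirling_nc \<alpha> \<gamma> n k = 0"
  by (simp add: gen_stirling_nc_def)

text \<open>The product rule and the equations for both factors give, for H = P^k R, that (1 - x)
  times the derivative of H is k P^(k-1) R - (k \<alpha> + \<gamma>) H. The recurrence compares the
  coefficients of x^n.\<close>

lemma gen_stirling_nc_Suc:
  "gen_stirling_nc \<alpha> \<gamma> (Suc n) k =
     (real n - real k * \<alpha> - \<gamma>) * gen_stirling_nc \<alpha> \<gamma> n k +
     (if k = 0 then 0 else gen_stirling_nc \<alpha> \<gamma> n (k - 1))"
proof -
  define P R where "P = stirling_fps \<alpha>" and "R = rising_fps (- \<gamma>)"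
  define H where "H = P ^ k * R"
  \<comment> \<open>Not the derivative of \<open>H\<close>, but the inhomogeneous term of its
    differential equation; the case distinction avoids a truncated exponent at k = 0.\<close>
  define H' where "H' = (if k = 0 then 0 else fps_const (real k) * (P ^ (k - 1) * R))"
  have P: "(1 - fps_X) * fps_deriv P = 1 - fps_const \<alpha> * P"
    and R: "(1 - fps_X) * fps_deriv R = fps_const (- \<gamma>) * R"
    unfolding P_def R_def by (rule stirling_fps_deriv rising_fps_deriv)+
  have "(1 - fps_X) * fps_deriv H = H' - fps_const (real k * \<alpha> + \<gamma>) * H"
  proof (cases k)
    case 0
    then show ?thesis using R by (simp add: H_def H'_def flip: fps_const_neg)
  next
    case (Suc h)
    have deriv: "fps_deriv (P ^ k) = fps_const (real k) * fps_deriv P * P ^ h"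
      by (subst fps_deriv_power) (simp add: Suc)
    have "(1 - fps_X) * fps_deriv H =
        fps_const (real k) * P ^ h * R * ((1 - fps_X) * fps_deriv P)
          + P ^ k * ((1 - fps_X) * fps_deriv R)"
      unfolding H_def fps_deriv_mult deriv by (simp only: algebra_simps)
    also have "\<dots> = H' - fps_const (real k * \<alpha> + \<gamma>) * H"
      unfolding P R
      by (simp add: H_def H'_def Suc algebra_simps flip: fps_const_add fps_const_mult fps_const_neg)
    finally show ?thesis .
  qed
  then have "((1 - fps_X) * fps_deriv H) $ n = (H' - fps_const (real k * \<alpha> + \<gamma>) * H) $ n"
    by simp
  \<comment> \<open>The part of the left side coming from -x is -n times coefficient n of
    \<open>H\<close>; moved to the right, it supplies the summand n of the factor.\<close>
  then have rec: "real (Suc n) * H $ Suc n = (real n - real k * \<alpha> - \<gamma>) * H $ n + H' $ n"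
    by (cases n) (auto simp: left_diff_distrib algebra_simps)
  have "gen_stirling_nc \<alpha> \<gamma> (Suc n) k = fact n / fact k * (real (Suc n) * H $ Suc n)"
    unfolding gen_stirling_nc_eq_fps_nth P_def[symmetric] R_def[symmetric] H_def[symmetric]
    by (simp add: field_simps)
  also have "\<dots> = (real n - real k * \<alpha> - \<gamma>) * (fact n / fact k * H $ n) + fact n / fact k * H' $ n"
    unfolding rec by (simp only: distrib_left mult_ac times_divide_eq_right times_divide_eq_left)
  \<comment> \<open>Uses k / k! = 1 / (k - 1)!.\<close>
  also have "fact n / fact k * H' $ n = (if k = 0 then 0 else gen_stirling_nc \<alpha> \<gamma> n (k - 1))"
    unfolding gen_stirling_nc_eq_fps_nth P_def[symmetric] R_def[symmetric]
    by (cases k) (simp_all add: H'_def del: of_nat_Suc)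
  also have "fact n / fact k * H $ n = gen_stirling_nc \<alpha> \<gamma> n k"
    unfolding gen_stirling_nc_eq_fps_nth P_def R_def H_def ..
  finally show ?thesis .
qed

subsection \<open>Extensions of a partition\<close>

lemma partition_on_restrict_partition:
  assumes "partition_on A P" and "{1..n} \<subseteq> A"
  shows "partition_on {1..n} (restrict_partition n P)"
proof -
  have "{1..n} \<inter> A = {1..n}" using assms(2) by auto
  with partition_on_restrict[OF assms(1), of "{1..n}"] show ?thesis
    by (simp add: restrict_partition_def Int_commute)
qed

lemma restrict_partition_restrict_partition:
  assumes "n \<le> N"
  shows "restrict_partition n (restrict_partition N Q) = restrict_partition n Q"
proof -
  have "{1..n} \<subseteq> {1..N}" using assms by auto
  then have eq: "B \<inter> {1..N} \<inter> {1..n} = B \<inter> {1..n}" for B by blast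
  \<comment> \<open>Discarding the empty set before applying a map that fixes it makes no difference
    once the empty set is discarded afterwards.\<close>
  have "f ` (S - {{}}) - {{}} = f ` S - {{}}" if "f {} = {}"
    for f :: "nat set \<Rightarrow> nat set" and S
    using that by auto
  then have "restrict_partition n (restrict_partition N Q) =
      (\<lambda>B. B \<inter> {1..n}) ` (\<lambda>B. B \<inter> {1..N}) ` Q - {{}}"
    unfolding restrict_partition_def by blast
  then show ?thesis
    unfolding image_image eq restrict_partition_def .
qed

lemma restrict_partition_same:
  assumes "partition_on {1..n} P"
  shows "restrict_partition n P = P"
proof -
  have "B \<inter> {1..n} = B" if "B \<in> P" for B
    using assms that by (auto simp: partition_on_def)
  then have "(\<lambda>B. B \<inter> {1..n}) ` P = P" by simp
  then show ?thesis using assms by (simp add: restrict_partition_def partition_on_def)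
qed

text \<open>Taking the block \<open>C\<close> to be empty adds \<open>{a}\<close> as a new block.\<close>

definition add_to_block :: "'b \<Rightarrow> 'b set \<Rightarrow> 'b set set \<Rightarrow> 'b set set" where
  "add_to_block a C Q = insert (insert a C) (Q - {C})"

lemma partition_on_block_subset: "partition_on A Q \<Longrightarrow> B \<in> insert {} Q \<Longrightarrow> B \<subseteq> A"
  by (auto simp: partition_on_def)

text \<open>A partition of {1..N + 1} is determined by its restriction to {1..N} and by the block
  that N + 1 joins, where the empty set stands for a new singleton.\<close>

lemma bij_betw_add_to_block:
  assumes Q: "partition_on {1..N} Q"
  shows "bij_betw (\<lambda>C. add_to_block (Suc N) C Q) (insert {} Q)
           {Q'. partition_on {1..Suc N} Q' \<and> restrict_partition N Q' = Q}"
proof -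
  have sub: "B \<subseteq> {1..N}" if "B \<in> insert {} Q" for B
    using partition_on_block_subset[OF Q that] .
  have new: "Suc N \<notin> B" if "B \<in> insert {} Q" for B
    using sub[OF that] by auto
  have ne: "{} \<notin> Q" and disj: "\<And>B C. B \<in> Q \<Longrightarrow> C \<in> Q \<Longrightarrow> B \<noteq> C \<Longrightarrow> B \<inter> C = {}"
    and un: "\<Union>Q = {1..N}"
    using Q by (auto simp: partition_on_def disjoint_def)
  have "partition_on {1..Suc N} (add_to_block (Suc N) C Q)
      \<and> restrict_partition N (add_to_block (Suc N) C Q) = Q" if C: "C \<in> insert {} Q" for C
  proof
    show "partition_on {1..Suc N} (add_to_block (Suc N) C Q)"
    proof (rule partition_onI)
      have "\<Union>(add_to_block (Suc N) C Q) = insert (Suc N) (\<Union>Q)"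
        using C by (auto simp: add_to_block_def)
      then show "\<Union>(add_to_block (Suc N) C Q) = {1..Suc N}"
        using un by auto
      show "{} \<notin> add_to_block (Suc N) C Q"
        using ne by (auto simp: add_to_block_def)
      have disj': "C \<inter> B = {}" if "B \<in> Q" "B \<noteq> C" for B
        using C disj that by blast
      show "disjnt p q"
        if pq: "p \<in> add_to_block (Suc N) C Q" "q \<in> add_to_block (Suc N) C Q" "p \<noteq> q" for p q
      proof -
        have X: "insert (Suc N) C \<inter> B = {}" if "B \<in> Q - {C}" for B
          using disj'[of B] new[of B] that by auto
        consider "p = insert (Suc N) C" "q \<in> Q - {C}" | "q = insert (Suc N) C" "p \<in> Q - {C}"
          | "p \<in> Q - {C}" "q \<in> Q - {C}"
          using pq unfolding add_to_block_def by blast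
        then show ?thesis
          by cases (use X disj \<open>p \<noteq> q\<close> in \<open>auto simp: disjnt_def\<close>)
      qed
    qed
    have "insert (Suc N) C \<inter> {1..N} = C" and "\<And>B. B \<in> Q \<Longrightarrow> B \<inter> {1..N} = B"
      using sub[OF C] sub by auto
    \<comment> \<open>If \<open>C\<close> is empty, the singleton leaves an empty trace, which
      \<open>restrict_partition\<close> removes.\<close>
    then have "restrict_partition N (add_to_block (Suc N) C Q) = insert C (Q - {C}) - {{}}"
      by (simp add: restrict_partition_def add_to_block_def)
    then show "restrict_partition N (add_to_block (Suc N) C Q) = Q"
      using C ne by auto
  qed
  moreover have "inj_on (\<lambda>C. add_to_block (Suc N) C Q) (insert {} Q)"
  proof (rule inj_onI)
    fix C C' assume C: "C \<in> insert {} Q" "C' \<in> insert {} Q"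
      and eq: "add_to_block (Suc N) C Q = add_to_block (Suc N) C' Q"
    \<comment> \<open>Only one block of either partition contains N + 1, so equal partitions force
      equal enlarged blocks.\<close>
    have "insert (Suc N) C \<in> add_to_block (Suc N) C' Q"
      unfolding eq[symmetric] by (simp add: add_to_block_def)
    then have "insert (Suc N) C = insert (Suc N) C'"
      using new unfolding add_to_block_def by blast
    then show "C = C'" using new[OF C(1)] new[OF C(2)] by (simp add: insert_ident)
  qed
  moreover have "Q' \<in> (\<lambda>C. add_to_block (Suc N) C Q) ` insert {} Q"
    if Q': "partition_on {1..Suc N} Q'" and res: "restrict_partition N Q' = Q" for Q'
  proof -
    have ne': "{} \<notin> Q'" and disj': "\<And>B C. B \<in> Q' \<Longrightarrow> C \<in> Q' \<Longrightarrow> B \<noteq> C \<Longrightarrow> B \<inter> C = {}"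
      and un': "\<Union>Q' = {1..Suc N}"
      using Q' by (auto simp: partition_on_def disjoint_def)
    have "Suc N \<in> \<Union>Q'" unfolding un' by simp
    then obtain D where D: "D \<in> Q'" "Suc N \<in> D" by blast
    have sub': "B \<subseteq> {1..Suc N}" if "B \<in> Q'" for B using un' that by auto
    \<comment> \<open>The preimage: the block of N + 1 without N + 1, which is empty if that block
      is a singleton.\<close>
    define C where "C = D - {Suc N}"
    have DN: "D \<inter> {1..N} = C" using sub'[OF D(1)] D(2) by (auto simp: C_def le_Suc_eq)
    have BN: "B \<inter> {1..N} = B" if "B \<in> Q'" "B \<noteq> D" for B
    proof -
      have "Suc N \<notin> B" using disj'[OF that(1) D(1) that(2)] D(2) by auto
      then show ?thesis using sub'[OF that(1)] by (auto simp: le_Suc_eq)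
    qed
    have "C \<in> insert {} Q"
      using DN D(1) res by (auto simp: restrict_partition_def)
    moreover have "Q' = add_to_block (Suc N) C Q"
    proof
      have D_eq: "D = insert (Suc N) C" using D(2) by (auto simp: C_def)
      show "Q' \<subseteq> add_to_block (Suc N) C Q"
      proof
        fix B assume B: "B \<in> Q'"
        show "B \<in> add_to_block (Suc N) C Q"
        proof (cases "B = D")
          case False
          have "B \<noteq> {}" using B ne' by auto
          moreover from this have "B \<in> Q"
            using BN[OF B False] B unfolding res[symmetric] restrict_partition_def by blast
          moreover have "B \<noteq> C" using disj'[OF B D(1) False] \<open>B \<noteq> {}\<close> by (auto simp: C_def)
          ultimately show ?thesis by (simp add: add_to_block_def)
        qed (simp add: D_eq add_to_block_def)
      qed
      show "add_to_block (Suc N) C Q \<subseteq> Q'"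
      proof
        fix B assume "B \<in> add_to_block (Suc N) C Q"
        then consider "B = D" | "B \<in> Q" "B \<noteq> C" by (auto simp: add_to_block_def D_eq)
        then show "B \<in> Q'"
        proof cases
          case 2
          then obtain B' where "B' \<in> Q'" "B = B' \<inter> {1..N}"
            unfolding res[symmetric] restrict_partition_def by blast
          then show ?thesis using 2(2) DN BN by metis
        qed (use D in simp)
      qed
    qed
    ultimately show ?thesis by blast
  qed
  ultimately show ?thesis
    unfolding bij_betw_def by blast
qed

section \<open>Block weights and the effect of adding one element\<close>

definition block_weight :: "real \<Rightarrow> nat set set \<Rightarrow> real" where
  "block_weight \<alpha> Q = (\<Prod>B\<in>Q. pochhammer (1 - \<alpha>) (card B - 1))"

lemma block_weight_pos: "\<alpha> < 1 \<Longrightarrow> block_weight \<alpha> Q > 0"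
  unfolding block_weight_def by (intro prod_pos) (simp add: pochhammer_pos)

lemma partition_on_finite_blocks:
  assumes "partition_on {1..N::nat} Q"
  shows "finite Q" and "\<And>C. C \<in> Q \<Longrightarrow> finite C" and "(\<Sum>C\<in>Q. card C) = N"
proof -
  show fin: "finite Q" using finite_elements[OF _ assms] by simp
  have "C \<subseteq> {1..N}" if "C \<in> Q" for C using assms that by (auto simp: partition_on_def)
  then show finC: "finite C" if "C \<in> Q" for C using that finite_subset by blast
  have "card (\<Union>Q) = (\<Sum>C\<in>Q. card C)"
    using assms finC by (intro card_Union_disjoint) (auto simp: partition_on_def)
  then show "(\<Sum>C\<in>Q. card C) = N" using assms by (simp add: partition_on_def)
qed

lemma card_partition_on_le:
  assumes "partition_on {1..N::nat} Q"
  shows "card Q \<le> N"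
proof -
  note fin = partition_on_finite_blocks[OF assms]
  have "1 \<le> card C" if "C \<in> Q" for C
    using fin(2)[OF that] that assms by (auto simp: partition_on_def Suc_le_eq card_gt_0_iff)
  then show ?thesis
    using sum_mono[of Q "\<lambda>_. 1" card] fin(3) by simp
qed

text \<open>Joining a block of size c turns (1 - \<alpha>)_(c-1) into (1 - \<alpha>)_c, a factor c -
  \<alpha>; a new singleton brings (1 - \<alpha>)_0 = 1.\<close>

lemma
  assumes Q: "partition_on {1..N} Q" and C: "C \<in> insert {} Q"
  shows card_add_to_block: "card (add_to_block (Suc N) C Q) = card Q + of_bool (C = {})"
    and block_weight_add_to_block: "block_weight \<alpha> (add_to_block (Suc N) C Q) =
      (if C = {} then 1 else real (card C) - \<alpha>) * block_weight \<alpha> Q"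
proof -
  have fin: "finite Q" and finC: "finite C"
    using partition_on_finite_blocks[OF Q] C by auto
  have ne: "{} \<notin> Q" using Q by (simp add: partition_on_def)
  have new: "Suc N \<notin> B" if "B \<in> insert {} Q" for B
    using partition_on_block_subset[OF Q that] by auto
  \<comment> \<open>The enlarged block does not coincide with a remaining one, so the insertion
    really adds an element to the set of blocks.\<close>
  have notin: "insert (Suc N) C \<notin> Q - {C}" using new by blast
  have newC: "Suc N \<notin> C" using new C by simp
  show "card (add_to_block (Suc N) C Q) = card Q + of_bool (C = {})"
  proof (cases "C = {}")
    case True
    then show ?thesis using fin notin ne by (simp add: add_to_block_def)
  next
    case False
    then have "card Q = Suc (card (Q - {C}))" using C card.remove[OF fin, of C] by simp
    then show ?thesis
      using fin notin False
      by (simp add: add_to_block_def del: card_Diff_singleton card_Diff_insert)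
  qed
  show "block_weight \<alpha> (add_to_block (Suc N) C Q) =
      (if C = {} then 1 else real (card C) - \<alpha>) * block_weight \<alpha> Q"
  proof (cases "C = {}")
    case True
    then show ?thesis using fin notin ne
      by (simp add: add_to_block_def block_weight_def)
  next
    case False
    then obtain c where c: "card C = Suc c"
      using finC by (metis card_0_eq not0_implies_Suc)
    have "block_weight \<alpha> Q = pochhammer (1 - \<alpha>) (card C - 1) * block_weight \<alpha> (Q - {C})"
      using False C prod.remove[OF fin, of C] by (simp add: block_weight_def)
    then show ?thesis using False fin notin finC newC c
      by (simp add: add_to_block_def block_weight_def pochhammer_Suc algebra_simps)
  qed
qed

text \<open>The added element lies outside {1..n}, so it does not affect which blocks contain
  \<open>B\<close>; it is counted exactly if the block it joins contains \<open>B\<close>. As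
  \<open>B\<close> is nonempty, founding a new block (\<open>C = {}\<close>) gives no gain.\<close>

lemma old_block_gain_add_to_block:
  assumes Q: "partition_on {1..n+m} Q" and C: "C \<in> insert {} Q" and B: "B \<subseteq> {1..n}" "B \<noteq> {}"
  shows "old_block_gain n (Suc m) B (add_to_block (Suc (n + m)) C Q) =
           old_block_gain n m B Q + of_bool (B \<subseteq> C)"
proof -
  let ?a = "Suc (n + m)"
  have new: "?a \<notin> D" if "D \<in> insert {} Q" for D
    using partition_on_block_subset[OF Q that] by auto
  have BC: "B \<subseteq> insert ?a C \<longleftrightarrow> B \<subseteq> C" using B by auto
  define U where "U x \<longleftrightarrow> (\<exists>D\<in>add_to_block ?a C Q. B \<subseteq> D \<and> x \<in> D)" for x
  define W where "W x \<longleftrightarrow> (\<exists>D\<in>Q. B \<subseteq> D \<and> x \<in> D)" for x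
  have a: "U ?a \<longleftrightarrow> B \<subseteq> C"
    using new BC by (auto simp: add_to_block_def U_def)
  have old: "U x \<longleftrightarrow> W x" if "x \<noteq> ?a" for x
  proof -
    have "U x \<longleftrightarrow> (B \<subseteq> C \<and> x \<in> C) \<or> (\<exists>D\<in>Q - {C}. B \<subseteq> D \<and> x \<in> D)"
      using that BC by (simp add: U_def add_to_block_def)
    also have "\<dots> \<longleftrightarrow> W x"
      using C unfolding W_def by blast
    finally show ?thesis .
  qed
  let ?S = "{x \<in> {n+1..n+m}. W x}"
  have "{n+1..n+Suc m} = insert ?a {n+1..n+m}" by auto
  then have "{x \<in> {n+1..n+Suc m}. U x} = {x \<in> insert ?a {n+1..n+m}. U x}" by (simp only:)
  also have "\<dots> = ?S \<union> (if B \<subseteq> C then {?a} else {})"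
    using a old by (auto simp del: atLeastAtMost_iff) (auto dest: old)
  finally have "card {x \<in> {n+1..n+Suc m}. U x} = card (?S \<union> (if B \<subseteq> C then {?a} else {}))"
    by (simp only:)
  also have "\<dots> = card ?S + of_bool (B \<subseteq> C)"
    by simp
  finally show ?thesis
    unfolding old_block_gain_def U_def W_def .
qed

section \<open>Old blocks within an extension of a partition\<close>

definition partition_extensions :: "nat \<Rightarrow> nat \<Rightarrow> nat set set \<Rightarrow> nat set set set" where
  "partition_extensions n m P = {Q. partition_on {1..n+m} Q \<and> restrict_partition n Q = P}"

lemma finite_partition_extensions: "finite (partition_extensions n m P)"
proof (rule finite_subset)
  show "partition_extensions n m P \<subseteq> Pow (Pow {1..n+m})"
    by (auto simp: partition_extensions_def partition_on_def)
qed simp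

text \<open>The old block grown out of \<open>B\<close>. The description is unique when
  \<open>Q\<close> extends a partition with block \<open>B\<close>: blocks of \<open>Q\<close> are
  disjoint and \<open>B\<close> is nonempty.\<close>

definition extended_block :: "nat set set \<Rightarrow> nat set \<Rightarrow> nat set" where
  "extended_block Q B = (THE C. C \<in> Q \<and> B \<subseteq> C)"

context
  fixes n m :: nat and P Q :: "nat set set"
  assumes Q: "Q \<in> partition_extensions n m P"
begin

lemma extension_block_unique:
  assumes "C \<in> Q" "D \<in> Q" "B \<subseteq> C" "B \<subseteq> D" "B \<in> P"
  shows "C = D"
proof -
  have "B \<noteq> {}" using Q assms(5) by (auto simp: partition_extensions_def restrict_partition_def)
  then have "C \<inter> D \<noteq> {}" using assms by blast
  moreover have "disjoint Q" using Q by (simp add: partition_extensions_def partition_on_def)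
  ultimately show ?thesis using assms by (auto simp: disjoint_def)
qed

lemma extended_block:
  assumes B: "B \<in> P"
  shows "extended_block Q B \<in> Q" and "extended_block Q B \<inter> {1..n} = B"
    and "\<And>C. C \<in> Q \<Longrightarrow> B \<subseteq> C \<longleftrightarrow> C = extended_block Q B"
    and "card (extended_block Q B) = card B + old_block_gain n m B Q"
proof -
  obtain C where C: "C \<in> Q" "B = C \<inter> {1..n}"
    using Q B by (auto simp: partition_extensions_def restrict_partition_def)
  have "extended_block Q B = C"
    unfolding extended_block_def
    by (rule the_equality) (use C extension_block_unique[OF _ _ _ _ B] in auto)
  with C have ext: "extended_block Q B \<in> Q" "extended_block Q B \<inter> {1..n} = B" by simp_all
  then show "extended_block Q B \<in> Q" "extended_block Q B \<inter> {1..n} = B" by simp_all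
  show unique: "B \<subseteq> C \<longleftrightarrow> C = extended_block Q B" if "C \<in> Q" for C
    using extension_block_unique[OF that ext(1) _ _ B] ext(2) by auto
  let ?E = "extended_block Q B"
  \<comment> \<open>The grown block is split at n: its part up to n is \<open>B\<close>, and the
    part above n is the set counted by the gain.\<close>
  have "?E \<subseteq> {1..n+m}"
    using Q ext(1) by (intro partition_on_block_subset[of _ Q]) (auto simp: partition_extensions_def)
  also have "\<dots> = {1..n} \<union> {n+1..n+m}" by auto
  finally have "?E = B \<union> ?E \<inter> {n+1..n+m}" using ext(2) by blast
  moreover have "?E \<inter> {n+1..n+m} = {x \<in> {n+1..n+m}. \<exists>C\<in>Q. B \<subseteq> C \<and> x \<in> C}"
    using unique ext(1) by auto
  ultimately have E: "?E = B \<union> {x \<in> {n+1..n+m}. \<exists>C\<in>Q. B \<subseteq> C \<and> x \<in> C}" by simp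
  have "B \<subseteq> {1..n}" using ext(2) by auto
  then have "finite B" "B \<inter> {x \<in> {n+1..n+m}. \<exists>C\<in>Q. B \<subseteq> C \<and> x \<in> C} = {}"
    using finite_subset by auto
  then show "card ?E = card B + old_block_gain n m B Q"
    unfolding old_block_gain_def by (subst E, subst card_Un_disjoint) auto
qed

lemma inj_on_extended_block: "inj_on (extended_block Q) P"
  by (rule inj_onI) (metis extended_block(2))

text \<open>Makes the number of new blocks, the excess of \<open>card Q\<close> over
  \<open>card P\<close>, a natural number.\<close>

lemma card_le_card_extension: "card P \<le> card Q"
proof (rule card_inj_on_le[OF inj_on_extended_block])
  show "extended_block Q ` P \<subseteq> Q" using extended_block(1) by auto
  show "finite Q"
    using Q partition_on_finite_blocks(1) by (auto simp: partition_extensions_def)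
qed

end

subsection \<open>Total weight of the extensions with prescribed gains\<close>

text \<open>Group the extensions by their restriction to {1..n + m};
  \<open>bij_betw_add_to_block\<close> parametrises each group by the block that the last element
  joins.\<close>

lemma sum_partition_extensions_Suc:
  "(\<Sum>Q'\<in>partition_extensions n (Suc m) P. f Q') =
     (\<Sum>Q\<in>partition_extensions n m P. \<Sum>C\<in>insert {} Q. f (add_to_block (Suc (n + m)) C Q))"
proof -
  let ?S = "partition_extensions n (Suc m) P" and ?T = "partition_extensions n m P"
  have "restrict_partition (n + m) ` ?S \<subseteq> ?T"
    using partition_on_restrict_partition[of "{1..n + Suc m}" _ "n + m"]
    by (auto simp: partition_extensions_def restrict_partition_restrict_partition)
  then have "(\<Sum>Q'\<in>?S. f Q') = (\<Sum>Q\<in>?T. \<Sum>Q'\<in>{Q' \<in> ?S. restrict_partition (n + m) Q' = Q}. f Q')"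
    by (intro sum.group [symmetric] finite_partition_extensions)
  also have "\<dots> = (\<Sum>Q\<in>?T. \<Sum>C\<in>insert {} Q. f (add_to_block (Suc (n + m)) C Q))"
  proof (rule sum.cong [OF refl])
    fix Q assume Q: "Q \<in> ?T"
    have "{Q' \<in> ?S. restrict_partition (n + m) Q' = Q} =
        {Q'. partition_on {1..Suc (n + m)} Q' \<and> restrict_partition (n + m) Q' = Q}"
      using Q restrict_partition_restrict_partition[of n "n + m"]
      by (auto simp: partition_extensions_def)
    then show "(\<Sum>Q'\<in>{Q' \<in> ?S. restrict_partition (n + m) Q' = Q}. f Q') =
        (\<Sum>C\<in>insert {} Q. f (add_to_block (Suc (n + m)) C Q))"
      using sum.reindex_bij_betw[OF bij_betw_add_to_block[of "n + m" Q], of f] Q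
      by (simp add: partition_extensions_def)
  qed
  finally show ?thesis .
qed

definition has_gains :: "nat \<Rightarrow> nat \<Rightarrow> nat set set \<Rightarrow> (nat set \<Rightarrow> nat) \<Rightarrow> nat set set \<Rightarrow> bool" where
  "has_gains n m X g Q \<longleftrightarrow> (\<forall>B\<in>X. old_block_gain n m B Q = g B)"

text \<open>Fixing the number k of new blocks makes the Gibbs factor V constant on the sum, so it
  can be left out here and restored when summing over k.\<close>

definition extension_sum ::
    "real \<Rightarrow> nat \<Rightarrow> nat \<Rightarrow> nat set set \<Rightarrow> nat set set \<Rightarrow> (nat set \<Rightarrow> nat) \<Rightarrow> nat \<Rightarrow> real" where
  "extension_sum \<alpha> n m P X g k =
     (\<Sum>Q\<in>partition_extensions n m P.
        of_bool (card Q = card P + k \<and> has_gains n m X g Q) * block_weight \<alpha> Q)"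

text \<open>The last element founds a block with weight 1, or joins a block of size c with weight c
  - \<alpha>. A selected block that ends with gain g has size \<open>card B + g - 1\<close> before
  being joined. The unselected blocks have total size n + m minus the selected sizes, and there are
  \<open>card P + k - card X\<close> of them, which gives the last coefficient.\<close>

lemma extension_sum_Suc:
  assumes P: "partition_on {1..n} P" and X: "X \<subseteq> P"
  shows "extension_sum \<alpha> n (Suc m) P X g k =
     (if k = 0 then 0 else extension_sum \<alpha> n m P X g (k - 1)) +
     (\<Sum>B\<in>X. (of_bool (g B \<noteq> 0) * (real (card B) + real (g B) - 1 - \<alpha>)) *
        extension_sum \<alpha> n m P X (g(B := g B - 1)) k) +
     (real n + real m - (\<Sum>B\<in>X. real (card B) + real (g B)) -
        (real (card P) + real k - real (card X)) * \<alpha>) * extension_sum \<alpha> n m P X g k"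
proof -
  let ?a = "Suc (n + m)"
  let ?c = "real n + real m - (\<Sum>B\<in>X. real (card B) + real (g B)) -
        (real (card P) + real k - real (card X)) * \<alpha>"
  \<comment> \<open>The contribution of a single \<open>Q\<close>, split by whether \<open>C\<close>
    is empty, an extension of a selected block, or another block.\<close>
  have block: "(\<Sum>C\<in>insert {} Q.
        of_bool (card (add_to_block ?a C Q) = card P + k \<and> has_gains n (Suc m) X g (add_to_block ?a C Q))
          * block_weight \<alpha> (add_to_block ?a C Q)) =
      of_bool (k \<noteq> 0) * (of_bool (card Q = card P + (k - 1) \<and> has_gains n m X g Q) * block_weight \<alpha> Q) +
      (\<Sum>B\<in>X. (of_bool (g B \<noteq> 0) * (real (card B) + real (g B) - 1 - \<alpha>)) *
        (of_bool (card Q = card P + k \<and> has_gains n m X (g(B := g B - 1)) Q) * block_weight \<alpha> Q)) +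
      ?c * (of_bool (card Q = card P + k \<and> has_gains n m X g Q) * block_weight \<alpha> Q)"
    (is "sum ?f _ = ?new + ?old + ?rest")
    if Q: "Q \<in> partition_extensions n m P" for Q
  proof -
    let ?D = "extended_block Q"
    have part: "partition_on {1..n + m} Q" using Q by (simp add: partition_extensions_def)
    note fin = partition_on_finite_blocks[OF part]
    have ne: "{} \<notin> Q" using part by (simp add: partition_on_def)
    have XB: "B \<subseteq> {1..n}" "B \<noteq> {}" if "B \<in> X" for B
      using that X P by (auto simp: partition_on_def)
    have DQ: "?D ` X \<subseteq> Q" using extended_block(1)[OF Q] X by auto
    have injD: "inj_on ?D X" using inj_on_extended_block[OF Q] X by (rule inj_on_subset)
    have gains: "has_gains n (Suc m) X g (add_to_block ?a C Q) \<longleftrightarrow>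
        (\<forall>B\<in>X. old_block_gain n m B Q + of_bool (B \<subseteq> C) = g B)" if "C \<in> insert {} Q" for C
      using old_block_gain_add_to_block[OF part that] XB by (simp add: has_gains_def)
    have f_new: "?f {} = ?new"
    proof -
      have "has_gains n (Suc m) X g (add_to_block ?a {} Q) \<longleftrightarrow> has_gains n m X g Q"
        using gains[of "{}"] XB by (simp add: has_gains_def)
      \<comment> \<open>At k = 0 the left side vanishes, because \<open>card Q + 1\<close> exceeds
        \<open>card P\<close>.\<close>
      then show ?thesis
        using card_add_to_block[OF part, of "{}"] block_weight_add_to_block[OF part, of "{}"]
          card_le_card_extension[OF Q] by (cases k) auto
    qed
    have f_old: "?f C = of_bool (card Q = card P + k \<and>
          (\<forall>B\<in>X. old_block_gain n m B Q + of_bool (B \<subseteq> C) = g B)) *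
          ((real (card C) - \<alpha>) * block_weight \<alpha> Q)" if "C \<in> Q" for C
    proof -
      have C: "C \<in> insert {} Q" "C \<noteq> {}" using that ne by auto
      show ?thesis
        using C(2) unfolding gains[OF C(1)] card_add_to_block[OF part C(1)]
          block_weight_add_to_block[OF part C(1)] by simp
    qed
    have sub: "B \<subseteq> C \<longleftrightarrow> C = ?D B" if "B \<in> X" "C \<in> Q" for B C
      using extended_block(3)[OF Q _ that(2)] that(1) X by blast
    have "sum ?f (?D ` X) = (\<Sum>B\<in>X. ?f (?D B))"
      using sum.reindex[OF injD, of ?f] by simp
    also have "\<dots> = ?old"
    proof (rule sum.cong [OF refl])
      fix B assume B: "B \<in> X"
      have DB: "?D B \<in> Q" using DQ B by auto
      \<comment> \<open>Distinct selected blocks have distinct extensions, so the new element raises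
        the gain of \<open>B\<close> alone.\<close>
      have "B' \<subseteq> ?D B \<longleftrightarrow> B' = B" if "B' \<in> X" for B'
        using sub[OF that DB] injD B that by (auto dest: inj_onD)
      then have "(\<forall>B'\<in>X. old_block_gain n m B' Q + of_bool (B' \<subseteq> ?D B) = g B') \<longleftrightarrow>
          (\<forall>B'\<in>X. old_block_gain n m B' Q + of_bool (B' = B) = g B')"
        by simp
      \<comment> \<open>Before the addition the gain of \<open>B\<close> must be one less; the
        condition \<open>g B \<noteq> 0\<close> guards the truncated subtraction.\<close>
      also have "\<dots> \<longleftrightarrow> g B \<noteq> 0 \<and> has_gains n m X (g(B := g B - 1)) Q"
        using B unfolding has_gains_def by (force split: if_splits)
      finally have iff: "(\<forall>B'\<in>X. old_block_gain n m B' Q + of_bool (B' \<subseteq> ?D B) = g B') \<longleftrightarrow>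
          g B \<noteq> 0 \<and> has_gains n m X (g(B := g B - 1)) Q" .
      have "card (?D B) = card B + old_block_gain n m B Q"
        using extended_block(4)[OF Q] B X by auto
      then have "real (card (?D B)) = real (card B) + real (g B) - 1"
        if "g B \<noteq> 0" "has_gains n m X (g(B := g B - 1)) Q"
        using that B by (simp add: has_gains_def of_nat_diff)
      then show "?f (?D B) = (of_bool (g B \<noteq> 0) * (real (card B) + real (g B) - 1 - \<alpha>)) *
        (of_bool (card Q = card P + k \<and> has_gains n m X (g(B := g B - 1)) Q) * block_weight \<alpha> Q)"
        unfolding f_old[OF DB] iff by auto
    qed
    finally have f_D: "sum ?f (?D ` X) = ?old" .
    \<comment> \<open>These blocks contain no selected block, so all prescribed gains must already
      hold for \<open>Q\<close>.\<close>
    have "sum ?f (Q - ?D ` X) = (\<Sum>C\<in>Q - ?D ` X.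
        of_bool (card Q = card P + k \<and> has_gains n m X g Q) * ((real (card C) - \<alpha>) * block_weight \<alpha> Q))"
    proof (rule sum.cong [OF refl])
      fix C assume C: "C \<in> Q - ?D ` X"
      then have "(\<forall>B\<in>X. old_block_gain n m B Q + of_bool (B \<subseteq> C) = g B) \<longleftrightarrow> has_gains n m X g Q"
        using sub unfolding has_gains_def by auto
      then show "?f C = of_bool (card Q = card P + k \<and> has_gains n m X g Q) *
          ((real (card C) - \<alpha>) * block_weight \<alpha> Q)"
        using f_old[of C] C by simp
    qed
    also have "\<dots> = (\<Sum>C\<in>Q - ?D ` X. real (card C) - \<alpha>) *
        (of_bool (card Q = card P + k \<and> has_gains n m X g Q) * block_weight \<alpha> Q)"
      by (simp add: sum_distrib_right sum_distrib_left mult_ac)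
    also have "\<dots> = ?rest"
    \<comment> \<open>Only for a contributing \<open>Q\<close> do the prescribed gains and k
      determine the sizes in the coefficient; otherwise both sides vanish.\<close>
    proof (cases "card Q = card P + k \<and> has_gains n m X g Q")
      case True
      have "(\<Sum>C\<in>Q - ?D ` X. real (card C) - \<alpha>) =
          (\<Sum>C\<in>Q. real (card C) - \<alpha>) - (\<Sum>C\<in>?D ` X. real (card C) - \<alpha>)"
        by (rule sum_diff[OF fin(1) DQ])
      also have "(\<Sum>C\<in>Q. real (card C) - \<alpha>) = real n + real m - (real (card P) + real k) * \<alpha>"
        using True fin(3) by (simp add: sum_subtractf flip: of_nat_sum)
      also have "(\<Sum>C\<in>?D ` X. real (card C) - \<alpha>) = (\<Sum>B\<in>X. real (card (?D B)) - \<alpha>)"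
        using sum.reindex[OF injD, of "\<lambda>C. real (card C) - \<alpha>"] by simp
      also have "\<dots> = (\<Sum>B\<in>X. real (card B) + real (g B) - \<alpha>)"
      proof (rule sum.cong [OF refl])
        fix B assume "B \<in> X"
        then show "real (card (?D B)) - \<alpha> = real (card B) + real (g B) - \<alpha>"
          using True extended_block(4)[OF Q, of B] X by (auto simp: has_gains_def)
      qed
      also have "\<dots> = (\<Sum>B\<in>X. real (card B) + real (g B)) - real (card X) * \<alpha>"
        by (simp add: sum_subtractf)
      finally have "(\<Sum>C\<in>Q - ?D ` X. real (card C) - \<alpha>) = ?c"
        by (simp add: algebra_simps)
      then show ?thesis by simp
    qed simp
    finally have f_rest: "sum ?f (Q - ?D ` X) = ?rest" .
    have "sum ?f Q = sum ?f (Q - ?D ` X) + sum ?f (?D ` X)"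
      by (rule sum.subset_diff[OF DQ fin(1)])
    moreover have "sum ?f (insert {} Q) = ?f {} + sum ?f Q"
      by (rule sum.insert[OF fin(1) ne])
    ultimately show ?thesis
      unfolding f_new f_D f_rest by (simp only: ac_simps)
  qed
  have "extension_sum \<alpha> n (Suc m) P X g k = (\<Sum>Q\<in>partition_extensions n m P.
      of_bool (k \<noteq> 0) * (of_bool (card Q = card P + (k - 1) \<and> has_gains n m X g Q) * block_weight \<alpha> Q) +
      (\<Sum>B\<in>X. (of_bool (g B \<noteq> 0) * (real (card B) + real (g B) - 1 - \<alpha>)) *
        (of_bool (card Q = card P + k \<and> has_gains n m X (g(B := g B - 1)) Q) * block_weight \<alpha> Q)) +
      ?c * (of_bool (card Q = card P + k \<and> has_gains n m X g Q) * block_weight \<alpha> Q))"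
    unfolding extension_sum_def sum_partition_extensions_Suc by (rule sum.cong [OF refl block])
  also have "\<dots> = of_bool (k \<noteq> 0) * extension_sum \<alpha> n m P X g (k - 1) +
     (\<Sum>B\<in>X. (of_bool (g B \<noteq> 0) * (real (card B) + real (g B) - 1 - \<alpha>)) *
        extension_sum \<alpha> n m P X (g(B := g B - 1)) k) + ?c * extension_sum \<alpha> n m P X g k"
    unfolding extension_sum_def sum.distrib sum_distrib_left by (subst (2) sum.swap) (rule refl)
  finally show ?thesis by simp
qed

lemma extension_sum_0:
  assumes P: "partition_on {1..n} P"
  shows "extension_sum \<alpha> n 0 P X g k = of_bool (k = 0 \<and> (\<forall>B\<in>X. g B = 0)) * block_weight \<alpha> P"
proof -
  have "partition_extensions n 0 P = {P}"
    using P restrict_partition_same by (auto simp: partition_extensions_def)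
  moreover have "old_block_gain n 0 B Q = 0" for B Q
    by (simp add: old_block_gain_def)
  ultimately show ?thesis
    by (auto simp: extension_sum_def has_gains_def)
qed

section \<open>Closed form of the total weight of the extensions\<close>

text \<open>The factor of \<open>extension_sum\<close> depending on the gains only through their sum \<open>s\<close>.\<close>

definition gain_total_weight :: "real \<Rightarrow> real \<Rightarrow> nat \<Rightarrow> nat \<Rightarrow> nat \<Rightarrow> real" where
  "gain_total_weight \<alpha> \<gamma> m s k =
     (if s \<le> m then fact m / fact (m - s) * gen_stirling_nc \<alpha> \<gamma> (m - s) k else 0)"

text \<open>With N = m - s, the new factorial factor m + 1 is (N + 1) + s. The part N + 1 cancels a
  denominator and leaves a Stirling number to which \<open>gen_stirling_nc_Suc\<close> applies; the
  part s is the term with s - 1.\<close>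

lemma gain_total_weight_Suc:
  "gain_total_weight \<alpha> \<gamma> (Suc m) s k =
     (if k = 0 then 0 else gain_total_weight \<alpha> \<gamma> m s (k - 1)) +
     real s * gain_total_weight \<alpha> \<gamma> m (s - 1) k +
     (real m - real s - real k * \<alpha> - \<gamma>) * gain_total_weight \<alpha> \<gamma> m s k"
proof -
  consider "s \<le> m" | "s = Suc m" | "s > Suc m" by linarith
  then show ?thesis
  proof cases
    case 1
    define N where "N = m - s"
    have m: "m = N + s" using 1 by (simp add: N_def)
    let ?S = "gen_stirling_nc \<alpha> \<gamma>"
    \<comment> \<open>At s = 0 the factor s removes the truncated s - 1; otherwise m - (s - 1) = N +
      1.\<close>
    have s1: "real s * gain_total_weight \<alpha> \<gamma> m (s - 1) k =
        real s * (fact m / (real (Suc N) * fact N) * ?S (Suc N) k)"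
    proof (cases s)
      case (Suc t)
      then have "m - t = Suc N" "t \<le> m" using m by simp_all
      then show ?thesis using Suc by (simp add: gain_total_weight_def)
    qed simp
    have "gain_total_weight \<alpha> \<gamma> (Suc m) s k =
        real (Suc N + s) * fact m / (real (Suc N) * fact N) * ?S (Suc N) k"
      using 1 by (simp add: gain_total_weight_def Suc_diff_le N_def)
    also have "\<dots> = fact m / fact N * ?S (Suc N) k +
        real s * (fact m / (real (Suc N) * fact N) * ?S (Suc N) k)"
      unfolding of_nat_add distrib_right add_divide_distrib by (simp del: of_nat_Suc)
    also have "?S (Suc N) k = (real N - real k * \<alpha> - \<gamma>) * ?S N k + (if k = 0 then 0 else ?S N (k - 1))"
      by (rule gen_stirling_nc_Suc)
    also have "fact m / fact N * \<dots> = (if k = 0 then 0 else gain_total_weight \<alpha> \<gamma> m s (k - 1)) +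
        (real m - real s - real k * \<alpha> - \<gamma>) * gain_total_weight \<alpha> \<gamma> m s k"
      unfolding distrib_left using m by (simp add: gain_total_weight_def)
    finally show ?thesis
      unfolding s1 gen_stirling_nc_Suc by simp
  next
    \<comment> \<open>Only the term with s - 1 = m survives; both sides are (m + 1)! times the
      Stirling number with first index 0.\<close>
    case 2
    then show ?thesis by (simp add: gain_total_weight_def gen_stirling_nc_0 algebra_simps)
  next
    case 3
    then show ?thesis by (auto simp: gain_total_weight_def)
  qed
qed

text \<open>Both sides satisfy the same recursion in m; the induction keeps \<open>g\<close> general
  because the recursion lowers gains. The negated parameter of the Stirling numbers is the sum of
  \<open>card B - \<alpha>\<close> over the unselected blocks of \<open>P\<close>.\<close>

lemma extension_sum_eq:
  assumes P: "partition_on {1..n} P" and X: "X \<subseteq> P"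
  shows "extension_sum \<alpha> n m P X g k =
     block_weight \<alpha> P * (\<Prod>B\<in>X. pochhammer (real (card B) - \<alpha>) (g B) / fact (g B)) *
     gain_total_weight \<alpha>
       (- (real n - (real (card P) - real (card X)) * \<alpha> - (\<Sum>B\<in>X. real (card B)))) m (sum g X) k"
    (is "_ = _ * ?\<Phi> g * gain_total_weight \<alpha> ?\<gamma> m (sum g X) k")
proof (induction m arbitrary: g k)
  case 0
  have "finite X" using X partition_on_finite_blocks(1)[OF P] finite_subset by blast
  then show ?case
    unfolding extension_sum_0[OF P]
    by (cases "\<forall>B\<in>X. g B = 0") (auto simp: gain_total_weight_def gen_stirling_nc_0)
next
  case (Suc m)
  let ?w = "gain_total_weight \<alpha> ?\<gamma>"
  have finX: "finite X" using X partition_on_finite_blocks(1)[OF P] finite_subset by blast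
  have step: "(of_bool (g B \<noteq> 0) * (real (card B) + real (g B) - 1 - \<alpha>)) *
      extension_sum \<alpha> n m P X (g(B := g B - 1)) k =
      real (g B) * (block_weight \<alpha> P * ?\<Phi> g * ?w m (sum g X - 1) k)" if B: "B \<in> X" for B
  proof (cases "g B")
    case (Suc h)
    let ?h = "g(B := g B - 1)"
    let ?p = "\<lambda>g B. pochhammer (real (card B) - \<alpha>) (g B) / fact (g B)"
    have "sum g X = g B + sum g (X - {B})" "sum ?h X = ?h B + sum ?h (X - {B})"
      by (rule sum.remove[OF finX B])+
    moreover have "sum ?h (X - {B}) = sum g (X - {B})" by (rule sum.cong) auto
    ultimately have sum: "sum ?h X = sum g X - 1" using Suc by simp
    have g: "?\<Phi> g = ?p g B * (\<Prod>C\<in>X - {B}. ?p g C)"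
      and h: "?\<Phi> ?h = ?p ?h B * (\<Prod>C\<in>X - {B}. ?p ?h C)"
      by (rule prod.remove[OF finX B])+
    have rest: "(\<Prod>C\<in>X - {B}. ?p ?h C) = (\<Prod>C\<in>X - {B}. ?p g C)"
      by (rule prod.cong) auto
    \<comment> \<open>With a = \<open>card B - \<alpha>\<close> and g B = h + 1: (a + h) (a)_h / h!
      = (h + 1) (a)_(h+1) / (h + 1)!. Lowering one gain thus costs just the factor g B, and these
      factors add up to the total gain.\<close>
    have B_factor: "(real (card B) + real (g B) - 1 - \<alpha>) * ?p ?h B = real (g B) * ?p g B"
      using Suc by (simp add: pochhammer_Suc del: of_nat_Suc)
    have "(real (card B) + real (g B) - 1 - \<alpha>) * ?\<Phi> ?h = real (g B) * ?\<Phi> g"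
      unfolding g h rest mult.assoc [symmetric] B_factor ..
    then show ?thesis
      unfolding Suc.IH sum using Suc by (simp add: mult_ac)
  qed simp
  have "(\<Sum>B\<in>X. (of_bool (g B \<noteq> 0) * (real (card B) + real (g B) - 1 - \<alpha>)) *
        extension_sum \<alpha> n m P X (g(B := g B - 1)) k) =
      real (sum g X) * (block_weight \<alpha> P * ?\<Phi> g * ?w m (sum g X - 1) k)"
    by (simp only: step sum_distrib_right of_nat_sum cong: sum.cong)
  moreover have "real n + real m - (\<Sum>B\<in>X. real (card B) + real (g B)) -
        (real (card P) + real k - real (card X)) * \<alpha> = real m - real (sum g X) - real k * \<alpha> - ?\<gamma>"
    by (simp add: sum.distrib algebra_simps)
  ultimately show ?case
    unfolding extension_sum_Suc[OF P X] gain_total_weight_Suc Suc.IH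
    by (simp add: algebra_simps)
qed

subsection \<open>Inclusion-exclusion and conditional laws\<close>

text \<open>If s elements satisfy \<open>p\<close>, the inner sum is binomial(s, r + y) and the
  factorials form binomial(r + y, y). Their product is binomial(s, y) binomial(s - y, r), and the
  alternating sum over r vanishes unless s = y.\<close>

lemma of_bool_card_eq_alternating_sum:
  assumes I: "finite I"
  shows "of_bool (card {i \<in> I. p i} = y) =
    (\<Sum>r\<le>card I. (- 1) ^ r * fact (r + y) / (fact y * fact r) *
       (\<Sum>X | X \<subseteq> I \<and> card X = r + y. of_bool (\<forall>i\<in>X. p i) :: real))"
proof -
  let ?S = "{i \<in> I. p i}"
  let ?s = "card ?S"
  have fin: "finite ?S" and le: "?s \<le> card I" using I by (auto intro: card_mono)
  have inner: "(\<Sum>X | X \<subseteq> I \<and> card X = t. of_bool (\<forall>i\<in>X. p i) :: real) = real (?s choose t)" for t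
  proof -
    have fin_X: "finite {X. X \<subseteq> I \<and> card X = t}"
      by (rule finite_subset[of _ "Pow I"]) (use I in auto)
    have "(\<Sum>X | X \<subseteq> I \<and> card X = t. of_bool (\<forall>i\<in>X. p i) :: real) =
        real (card ({X. X \<subseteq> I \<and> card X = t} \<inter> {X. \<forall>i\<in>X. p i}))"
      using fin_X by (simp only: sum_of_bool_eq)
    also have "{X. X \<subseteq> I \<and> card X = t} \<inter> {X. \<forall>i\<in>X. p i} = {X. X \<subseteq> ?S \<and> card X = t}"
      by auto
    finally show ?thesis using n_subsets[OF fin] by simp
  qed
  have summand: "(- 1) ^ r * fact (r + y) / (fact y * fact r) * real (?s choose (r + y)) =
      real (?s choose y) * ((- 1) ^ r * real ((?s - y) choose r))" for r
  proof (cases "r + y \<le> ?s")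
    case True
    have "fact (r + y) / (fact y * fact r) = real ((r + y) choose y)"
      by (simp add: binomial_fact)
    moreover have "real (?s choose (r + y)) * real ((r + y) choose y) =
        real (?s choose y) * real ((?s - y) choose r)"
      using choose_mult[of y "r + y" ?s] True by (simp flip: of_nat_mult)
    moreover have "(- 1) ^ r * fact (r + y) / (fact y * fact r) * real (?s choose (r + y)) =
        (- 1) ^ r * (real (?s choose (r + y)) * (fact (r + y) / (fact y * fact r)))"
      by simp
    ultimately show ?thesis
      by (simp only: mult.left_commute)
  next
    case False
    then have "real (?s choose (r + y)) = 0" "real (?s choose y) = 0 \<or> real ((?s - y) choose r) = 0"
      by (auto simp: binomial_eq_0_iff)
    then show ?thesis by (metis mult_zero_left mult_zero_right)
  qed
  have "(\<Sum>r\<le>card I. (- 1) ^ r * fact (r + y) / (fact y * fact r) *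
       (\<Sum>X | X \<subseteq> I \<and> card X = r + y. of_bool (\<forall>i\<in>X. p i) :: real)) =
      real (?s choose y) * (\<Sum>r\<le>card I. (- 1) ^ r * real ((?s - y) choose r))"
    unfolding inner summand sum_distrib_left ..
  also have "(\<Sum>r\<le>card I. (- 1) ^ r * real ((?s - y) choose r)) =
      (\<Sum>r\<le>?s - y. (- 1) ^ r * real ((?s - y) choose r))"
    using le by (intro sum.mono_neutral_right) auto
  \<comment> \<open>For s < y the truncated s - y is 0 and the sum is 1, but the outer binomial
    coefficient vanishes.\<close>
  also have "real (?s choose y) * \<dots> = of_bool (?s = y)"
    using choose_alternating_sum[of "?s - y", where ?'a = real]
    by (cases "?s < y"; cases "?s = y") auto
  finally show ?thesis by simp
qed

text \<open>The blocks of \<open>Q\<close> meeting {1..n} are exactly the extensions of the blocks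
  \<open>A i\<close>, without repetition, and their sizes are the old sizes plus the gains.\<close>

lemma old_species_eq_old_blocks_of_size:
  assumes Q: "Q \<in> partition_extensions n m (A ` {1..j})" and A: "inj_on A {1..j}"
  shows "old_species n l Q = old_blocks_of_size n m l j A Q"
proof -
  let ?I = "{i \<in> {1..j}. card (A i) \<le> l} \<inter> {i. card (A i) + old_block_gain n m (A i) Q = l}"
  let ?D = "\<lambda>i. extended_block Q (A i)"
  have D: "?D i \<in> Q" "?D i \<inter> {1..n} = A i" "card (?D i) = card (A i) + old_block_gain n m (A i) Q"
    if "i \<in> {1..j}" for i
    using extended_block(1,2,4)[OF Q] that by auto
  have res: "restrict_partition n Q = A ` {1..j}"
    using Q by (simp add: partition_extensions_def)
  have "{} \<notin> A ` {1..j}"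
    unfolding res[symmetric] restrict_partition_def by simp
  then have ne: "A i \<noteq> {}" if "i \<in> {1..j}" for i
    using that by (metis imageI)
  have "{C \<in> Q. C \<inter> {1..n} \<noteq> {} \<and> card C = l} = ?D ` ?I"
  proof
    show "?D ` ?I \<subseteq> {C \<in> Q. C \<inter> {1..n} \<noteq> {} \<and> card C = l}"
      using D ne by force
    show "{C \<in> Q. C \<inter> {1..n} \<noteq> {} \<and> card C = l} \<subseteq> ?D ` ?I"
    proof
      fix C assume C: "C \<in> {C \<in> Q. C \<inter> {1..n} \<noteq> {} \<and> card C = l}"
      then have "C \<inter> {1..n} \<in> A ` {1..j}"
        unfolding res[symmetric] restrict_partition_def by blast
      then obtain i where i: "i \<in> {1..j}" "C \<inter> {1..n} = A i" by auto
      then have "C = ?D i" using extended_block(3)[OF Q, of "A i" C] C by auto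
      moreover from this have "i \<in> ?I" using D(3)[OF i(1)] i(1) C by auto
      ultimately show "C \<in> ?D ` ?I" by blast
    qed
  qed
  moreover have "inj_on ?D ?I"
  proof -
    have "inj_on (extended_block Q \<circ> A) {1..j}"
      by (rule comp_inj_on[OF A inj_on_extended_block[OF Q]])
    then have "inj_on ?D {1..j}" by (simp add: comp_def)
    then show ?thesis by (rule inj_on_subset) auto
  qed
  ultimately have "old_species n l Q = card ?I"
    by (simp add: old_species_def card_image)
  then show ?thesis
    unfolding old_blocks_of_size_def by (subst sum_of_bool_eq) simp_all
qed

text \<open>Every measurable set of the generated algebra is a preimage under \<open>X\<close>, so
  the conditional expectation is constant on each fibre of \<open>X\<close>. Integrating over a
  fibre of positive probability gives its value pointwise, not merely almost everywhere.\<close>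

lemma (in prob_space) real_cond_exp_vimage_count_space:
  assumes X: "X \<in> measurable M (count_space UNIV)" and f: "integrable M f"
    and \<omega>: "\<omega> \<in> space M" and pos: "\<P>(\<omega>' in M. X \<omega>' = X \<omega>) > 0"
  shows "real_cond_exp M (vimage_algebra (space M) X (count_space UNIV)) f \<omega> =
    (\<integral>\<omega>'\<in>{\<omega>' \<in> space M. X \<omega>' = X \<omega>}. f \<omega>' \<partial>M) / \<P>(\<omega>' in M. X \<omega>' = X \<omega>)"
proof -
  let ?F = "vimage_algebra (space M) X (count_space UNIV)"
  let ?E = "real_cond_exp M ?F f"
  let ?A = "{\<omega>' \<in> space M. X \<omega>' = X \<omega>}"
  have sets_F: "sets ?F = {X -` T \<inter> space M | T. True}"
    by (subst sets_vimage_algebra2) auto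
  have "sets ?F \<subseteq> sets M"
    using X by (intro sets_image_in_sets) auto
  then have "subalgebra M ?F"
    by (simp add: subalgebra_def)
  then interpret finite_measure_subalgebra M ?F
    by unfold_locales
  have A: "?A \<in> sets ?F" unfolding sets_F by (auto intro: exI[of _ "{X \<omega>}"])
  \<comment> \<open>A level set of the conditional expectation is a preimage under \<open>X\<close>,
    hence contains the whole fibre through \<omega>.\<close>
  have "?E -` {?E \<omega>} \<inter> space ?F \<in> sets ?F"
    by (rule measurable_sets[OF borel_measurable_cond_exp]) simp
  then obtain T where T: "?E -` {?E \<omega>} \<inter> space M = X -` T \<inter> space M"
    unfolding sets_F by auto
  have const: "?E \<omega>' = ?E \<omega>" if "\<omega>' \<in> ?A" for \<omega>'
  proof -
    have "X \<omega> \<in> T" using T \<omega> by auto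
    then have "\<omega>' \<in> X -` T \<inter> space M" using that by auto
    then show ?thesis using T by auto
  qed
  have "(\<integral>\<omega>'\<in>?A. f \<omega>' \<partial>M) = (\<integral>\<omega>'\<in>?A. ?E \<omega>' \<partial>M)"
    by (rule real_cond_exp_intA[OF f A])
  also have "\<dots> = (\<integral>\<omega>'\<in>?A. ?E \<omega> \<partial>M)"
    using A \<open>sets ?F \<subseteq> sets M\<close> const by (intro set_lebesgue_integral_cong) auto
  also have "\<dots> = prob ?A * ?E \<omega>"
    using A \<open>sets ?F \<subseteq> sets M\<close> by (auto simp: set_lebesgue_integral_def)
  finally show ?thesis using pos by (simp add: field_simps)
qed

section \<open>Conditional laws of the gains in a Gibbs partition\<close>

context gibbs_partition
begin

lemma pred_restrict [measurable]:
  "Measurable.pred M (\<lambda>\<omega>. F (restrict_partition n (\<pi> \<omega>)))"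
  by (rule measurable_compose[OF measurable_restrict, of F]) simp

lemma restrict_extends:
  assumes "\<omega> \<in> space M"
  shows "restrict_partition (n + m) (\<pi> \<omega>) \<in> partition_extensions n m (restrict_partition n (\<pi> \<omega>))"
  unfolding partition_extensions_def mem_Collect_eq
proof
  show "partition_on {1..n + m} (restrict_partition (n + m) (\<pi> \<omega>))"
    by (rule partition_on_restrict_partition[OF partition[OF assms]]) auto
qed (rule restrict_partition_restrict_partition, simp)

text \<open>The joint event is the finite disjoint union, over the extensions \<open>Q\<close> of
  \<open>P\<close> satisfying \<open>F\<close>, of the events that the larger restriction equals
  \<open>Q\<close>.\<close>

lemma cond_prob_extension:
  assumes n: "n \<ge> 1" and P: "partition_on {1..n} P"
  shows "\<P>(\<omega> in M. F (restrict_partition (n + m) (\<pi> \<omega>)) \<bar> restrict_partition n (\<pi> \<omega>) = P) =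
    (\<Sum>Q\<in>partition_extensions n m P.
       of_bool (F Q) * (V (n + m) (card Q) * block_weight \<alpha> Q)) / (V n (card P) * block_weight \<alpha> P)"
proof -
  let ?S = "{Q \<in> partition_extensions n m P. F Q}"
  let ?R = "\<lambda>Q. {\<omega> \<in> space M. restrict_partition (n + m) (\<pi> \<omega>) = Q}"
  have "{\<omega> \<in> space M. F (restrict_partition (n + m) (\<pi> \<omega>)) \<and> restrict_partition n (\<pi> \<omega>) = P} =
      (\<Union>Q\<in>?S. ?R Q)"
  proof (rule set_eqI)
    fix \<omega>
    have "restrict_partition n (\<pi> \<omega>) = P"
      if "restrict_partition (n + m) (\<pi> \<omega>) \<in> partition_extensions n m P"
      using that by (simp add: partition_extensions_def restrict_partition_restrict_partition)
    then show "\<omega> \<in> {\<omega> \<in> space M. F (restrict_partition (n + m) (\<pi> \<omega>)) \<and> restrict_partition n (\<pi> \<omega>) = P} \<longleftrightarrow>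
        \<omega> \<in> (\<Union>Q\<in>?S. ?R Q)"
      using restrict_extends[of \<omega> n m] by auto
  qed
  moreover have "measure M (\<Union>Q\<in>?S. ?R Q) = (\<Sum>Q\<in>?S. measure M (?R Q))"
    using finite_partition_extensions
    by (intro finite_measure_finite_Union) (auto simp: disjoint_family_on_def)
  moreover have "measure M (?R Q) = V (n + m) (card Q) * block_weight \<alpha> Q" if "Q \<in> ?S" for Q
    unfolding block_weight_def
    using that n by (intro prob_restrict) (auto simp: partition_extensions_def)
  ultimately have "\<P>(\<omega> in M. F (restrict_partition (n + m) (\<pi> \<omega>)) \<and> restrict_partition n (\<pi> \<omega>) = P) =
      (\<Sum>Q\<in>?S. V (n + m) (card Q) * block_weight \<alpha> Q)"
    by simp
  also have "\<dots> = (\<Sum>Q\<in>partition_extensions n m P.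
      of_bool (F Q) * (V (n + m) (card Q) * block_weight \<alpha> Q))"
    by (rule sum.mono_neutral_cong_left) (auto simp: finite_partition_extensions)
  finally show ?thesis
    using prob_restrict[OF n P] by (simp add: cond_prob_def block_weight_def)
qed

text \<open>Sorting the extensions by the number k of new blocks reduces the claim to
  \<open>extension_sum_eq\<close>; the block weight of \<open>P\<close> then cancels against the
  denominator.\<close>

lemma cond_prob_has_gains:
  assumes n: "n \<ge> 1" and P: "partition_on {1..n} P" and X: "X \<subseteq> P"
  shows "\<P>(\<omega> in M. has_gains n m X g (restrict_partition (n + m) (\<pi> \<omega>)) \<bar>
      restrict_partition n (\<pi> \<omega>) = P) =
    (\<Prod>B\<in>X. pochhammer (real (card B) - \<alpha>) (g B) / fact (g B)) / V n (card P) *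
    (if sum g X \<le> m then
       fact m / fact (m - sum g X) * (\<Sum>k=0..m - sum g X. V (n + m) (card P + k) *
         gen_stirling_nc \<alpha>
           (- (real n - (real (card P) - real (card X)) * \<alpha> - (\<Sum>B\<in>X. real (card B))))
           (m - sum g X) k)
     else 0)"
    (is "_ = ?\<Phi> / _ * ?T")
proof -
  let ?\<gamma> = "- (real n - (real (card P) - real (card X)) * \<alpha> - (\<Sum>B\<in>X. real (card B)))"
  let ?w = "\<lambda>k. gain_total_weight \<alpha> ?\<gamma> m (sum g X) k"
  \<comment> \<open>Each \<open>Q\<close> matches exactly one k, and k \<le> n + m because
    \<open>Q\<close> has at most n + m blocks.\<close>
  have "(\<Sum>Q\<in>partition_extensions n m P.
        of_bool (has_gains n m X g Q) * (V (n + m) (card Q) * block_weight \<alpha> Q)) =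
      (\<Sum>Q\<in>partition_extensions n m P. \<Sum>k\<in>{0..n+m}. V (n + m) (card P + k) *
        (of_bool (card Q = card P + k \<and> has_gains n m X g Q) * block_weight \<alpha> Q))"
  proof (rule sum.cong [OF refl])
    fix Q assume Q: "Q \<in> partition_extensions n m P"
    then have part: "partition_on {1..n + m} Q" by (simp add: partition_extensions_def)
    obtain h where h: "card Q = card P + h"
      using card_le_card_extension[OF Q] le_Suc_ex by blast
    have "h \<in> {0..n+m}" using card_partition_on_le[OF part] h by simp
    then show "of_bool (has_gains n m X g Q) * (V (n + m) (card Q) * block_weight \<alpha> Q) =
        (\<Sum>k\<in>{0..n+m}. V (n + m) (card P + k) *
          (of_bool (card Q = card P + k \<and> has_gains n m X g Q) * block_weight \<alpha> Q))"
      unfolding h by (subst sum.mono_neutral_cong_right[of _ "{h}"]) auto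
  qed
  also have "\<dots> = (\<Sum>k\<in>{0..n+m}. V (n + m) (card P + k) * extension_sum \<alpha> n m P X g k)"
    unfolding extension_sum_def sum_distrib_left by (rule sum.swap)
  also have "\<dots> = block_weight \<alpha> P * ?\<Phi> * (\<Sum>k\<in>{0..n+m}. V (n + m) (card P + k) * ?w k)"
    unfolding extension_sum_eq[OF P X] sum_distrib_left by (simp only: mult_ac)
  also have "(\<Sum>k\<in>{0..n+m}. V (n + m) (card P + k) * ?w k) = ?T"
  proof (cases "sum g X \<le> m")
    case True
    \<comment> \<open>The Stirling numbers vanish once k exceeds their first index, so the crude
      range shrinks to the stated one.\<close>
    have "(\<Sum>k\<in>{0..n+m}. V (n + m) (card P + k) * ?w k) =
        (\<Sum>k=0..m - sum g X. V (n + m) (card P + k) * ?w k)"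
      by (rule sum.mono_neutral_right) (auto simp: gain_total_weight_def gen_stirling_nc_eq_0)
    then show ?thesis
      using True by (simp add: gain_total_weight_def sum_distrib_left mult_ac)
  qed (simp add: gain_total_weight_def)
  finally show ?thesis
    unfolding cond_prob_extension[OF n P]
    using block_weight_pos[OF alpha_less_1, of P] by simp
qed

text \<open>Index form of the previous law for the gains that bring each selected block to size l.
  Since the sizes are at most l, the subtractions are exact and the total gain is
  \<open>card X * l\<close> minus the total size.\<close>

lemma cond_prob_old_block_gains:
  assumes n: "n \<ge> 1" and P: "partition_on {1..n} (A ` {1..j})" and A: "inj_on A {1..j}"
    and X: "X \<subseteq> {1..j}" and size: "\<And>i. i \<in> X \<Longrightarrow> card (A i) \<le> l"
  shows "\<P>(\<omega> in M. (\<forall>i\<in>X. old_block_gain n m (A i) (restrict_partition (n + m) (\<pi> \<omega>)) = l - card (A i)) \<bar>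
      restrict_partition n (\<pi> \<omega>) = A ` {1..j}) =
    (if card X * l \<le> m + (\<Sum>i\<in>X. card (A i)) then
       1 / V n j *
       (let N = m + (\<Sum>i\<in>X. card (A i)) - card X * l in
        fact m * (\<Prod>i\<in>X. pochhammer (real (card (A i)) - \<alpha>) (l - card (A i))) /
          ((\<Prod>i\<in>X. fact (l - card (A i))) * fact N) *
        (\<Sum>k=0..N. V (n + m) (j + k) *
           gen_stirling_nc \<alpha>
             (- (real n - (real j - real (card X)) * \<alpha> - (\<Sum>i\<in>X. real (card (A i))))) N k))
     else 0)"
proof -
  let ?g = "\<lambda>B. l - card B"
  have inj: "inj_on A X" using A X by (rule inj_on_subset)
  have card: "card (A ` {1..j}) = j" "card (A ` X) = card X"
    using card_image[OF A] card_image[OF inj] by simp_all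
  have "sum ?g (A ` X) + (\<Sum>i\<in>X. card (A i)) = (\<Sum>i\<in>X. (l - card (A i)) + card (A i))"
    by (simp add: sum.reindex[OF inj] sum.distrib)
  also have "\<dots> = card X * l"
    using size by simp
  finally have sum: "sum ?g (A ` X) + (\<Sum>i\<in>X. card (A i)) = card X * l" .
  then have le: "sum ?g (A ` X) \<le> m \<longleftrightarrow> card X * l \<le> m + (\<Sum>i\<in>X. card (A i))"
    and N: "m - sum ?g (A ` X) = m + (\<Sum>i\<in>X. card (A i)) - card X * l"
    by linarith+
  have "has_gains n m (A ` X) ?g Q \<longleftrightarrow> (\<forall>i\<in>X. old_block_gain n m (A i) Q = l - card (A i))" for Q
    by (simp add: has_gains_def)
  moreover have "A ` X \<subseteq> A ` {1..j}" using X by blast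
  ultimately show ?thesis
    using cond_prob_has_gains[OF n P, of "A ` X" m ?g]
    unfolding card le N prod.reindex[OF inj] sum.reindex[OF inj, of "\<lambda>B. real (card B)"] Let_def comp_def
    by (simp add: prod_dividef mult_ac)
qed

end

theorem proposition11:
  fixes M :: "'a measure" and \<alpha> :: real and V :: "nat \<Rightarrow> nat \<Rightarrow> real"
    and \<pi> :: "'a \<Rightarrow> nat set set"
    and n m j l :: nat and A :: "nat \<Rightarrow> nat set" and ns :: "nat \<Rightarrow> nat"
  assumes "gibbs_partition M \<alpha> V \<pi>"
    and "n \<ge> 1" and "m \<ge> 1"
    and "partition_on {1..n} (A ` {1..j})" and "inj_on A {1..j}"
    and "\<And>i. i \<in> {1..j} \<Longrightarrow> card (A i) = ns i"
    and "V n j > 0"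
    and "l \<in> {1..n+m}"
  defines "observed \<equiv> (\<lambda>\<omega>. restrict_partition n (\<pi> \<omega>) = A ` {1..j})"
    and "Mgain \<equiv> (\<lambda>i \<omega>. old_block_gain n m (A i) (restrict_partition (n + m) (\<pi> \<omega>)))"
    and "Ol \<equiv> (\<lambda>\<omega>. old_blocks_of_size n m l j A (restrict_partition (n + m) (\<pi> \<omega>)))"
    and "estimate \<equiv>
      (\<Sum>i\<in>{i \<in> {1..j}. ns i \<le> l}.
         real (m choose (l - ns i)) * (pochhammer (real (ns i) - \<alpha>) (l - ns i) / V n j) *
         (\<Sum>k=0..m + ns i - l.
            V (n + m) (j + k) *
            gen_stirling_nc \<alpha> (- (real n - real j * \<alpha> + \<alpha> - real (ns i))) (m + ns i - l) k))"
  shows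
    "(\<forall>y::nat.
       (\<lambda>r::nat.
          (- 1) ^ r * fact (r + y) / (fact y * fact r) * (1 / V n j) *
          (\<Sum>X | X \<subseteq> {i \<in> {1..j}. ns i \<le> l} \<and> card X = r + y \<and>
                  r * l + y * l \<le> m + (\<Sum>i\<in>X. ns i).
             let N = m + (\<Sum>i\<in>X. ns i) - (r * l + y * l) in
             fact m * (\<Prod>i\<in>X. pochhammer (real (ns i) - \<alpha>) (l - ns i)) /
               ((\<Prod>i\<in>X. fact (l - ns i)) * fact N) *
             (\<Sum>k=0..N.
                V (n + m) (j + k) *
                gen_stirling_nc \<alpha>
                  (- (real n - (real j - real r - real y) * \<alpha> - (\<Sum>i\<in>X. real (ns i)))) N k)))
       sums \<P>(\<omega> in M. Ol \<omega> = y \<bar> observed \<omega>))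
     \<and> (\<integral>\<omega>. real (Ol \<omega>) \<partial>uniform_measure M {\<omega> \<in> space M. observed \<omega>}) =
         (\<Sum>i\<in>{i \<in> {1..j}. ns i \<le> l}. \<P>(\<omega> in M. Mgain i \<omega> = l - ns i \<bar> observed \<omega>))
     \<and> (\<Sum>i\<in>{i \<in> {1..j}. ns i \<le> l}. \<P>(\<omega> in M. Mgain i \<omega> = l - ns i \<bar> observed \<omega>)) = estimate
     \<and> (AE \<omega> in M. observed \<omega> \<longrightarrow>
          bayes_estimator M \<pi> n
            (\<lambda>\<omega>'. real (old_species n l (restrict_partition (n + m) (\<pi> \<omega>')))) \<omega> = estimate)"
proof -
  interpret gibbs_partition M \<alpha> V \<pi> by fact
  note n = \<open>n \<ge> 1\<close> and P = assms(4) and A = assms(5) and ns = assms(6) and V = \<open>V n j > 0\<close>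
  let ?P = "A ` {1..j}"
  let ?I = "{i \<in> {1..j}. ns i \<le> l}"
  let ?E = "partition_extensions n m ?P"
  let ?R = "\<lambda>\<omega>. restrict_partition (n + m) (\<pi> \<omega>)"
  let ?obs = "{\<omega> \<in> space M. observed \<omega>}"
  let ?U = "uniform_measure M ?obs"
  have finI: "finite ?I" by simp
  have card_P: "card ?P = j" using card_image[OF A] by simp
  \<comment> \<open>The conditional probability of the extension \<open>Q\<close>. Writing all
    conditional probabilities as sums against \<open>d\<close> lets identities be applied for each
    \<open>Q\<close> separately.\<close>
  define d where "d Q = V (n + m) (card Q) * block_weight \<alpha> Q / (V n j * block_weight \<alpha> ?P)" for Q
  have cond: "\<P>(\<omega> in M. F (?R \<omega>) \<bar> observed \<omega>) = (\<Sum>Q\<in>?E. of_bool (F Q) * d Q)" for F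
    unfolding observed_def cond_prob_extension[OF n P] card_P d_def sum_divide_distrib
    by simp
  have gains: "\<P>(\<omega> in M. \<forall>i\<in>X. Mgain i \<omega> = l - ns i \<bar> observed \<omega>) =
      (if card X * l \<le> m + (\<Sum>i\<in>X. ns i) then
       1 / V n j *
       (let N = m + (\<Sum>i\<in>X. ns i) - card X * l in
        fact m * (\<Prod>i\<in>X. pochhammer (real (ns i) - \<alpha>) (l - ns i)) /
          ((\<Prod>i\<in>X. fact (l - ns i)) * fact N) *
        (\<Sum>k=0..N. V (n + m) (j + k) *
           gen_stirling_nc \<alpha>
             (- (real n - (real j - real (card X)) * \<alpha> - (\<Sum>i\<in>X. real (ns i)))) N k))
     else 0)" if X: "X \<subseteq> ?I" for X
  proof -
    have eq: "card (A i) = ns i" if "i \<in> X" for i using X that ns by auto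
    have "X \<subseteq> {1..j}" "\<And>i. i \<in> X \<Longrightarrow> card (A i) \<le> l" using X eq by auto
    from cond_prob_old_block_gains[OF n P A this, of m] show ?thesis
      unfolding observed_def Mgain_def by (simp add: eq cong: sum.cong prod.cong ball_cong)
  qed
  have Ol_sum: "old_blocks_of_size n m l j A Q =
      (\<Sum>i\<in>?I. of_bool (old_block_gain n m (A i) Q = l - ns i))" for Q
  proof -
    have "{i \<in> {1..j}. card (A i) \<le> l} = ?I" using ns by auto
    then show ?thesis
      unfolding old_blocks_of_size_def using ns by (intro sum.cong) auto
  qed
  have Ol_card: "old_blocks_of_size n m l j A Q =
      card {i \<in> ?I. old_block_gain n m (A i) Q = l - ns i}" for Q
  proof -
    have "?I \<inter> {i. old_block_gain n m (A i) Q = l - ns i} =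
        {i \<in> ?I. old_block_gain n m (A i) Q = l - ns i}" by blast
    then show ?thesis
      unfolding Ol_sum sum_of_bool_eq[OF finI finI] by (simp only: of_nat_id)
  qed
  have expected: "(\<Sum>i\<in>?I. \<P>(\<omega> in M. Mgain i \<omega> = l - ns i \<bar> observed \<omega>)) = estimate"
    unfolding estimate_def
  proof (rule sum.cong [OF refl])
    fix i assume i: "i \<in> ?I"
    show "\<P>(\<omega> in M. Mgain i \<omega> = l - ns i \<bar> observed \<omega>) =
         real (m choose (l - ns i)) * (pochhammer (real (ns i) - \<alpha>) (l - ns i) / V n j) *
         (\<Sum>k=0..m + ns i - l. V (n + m) (j + k) *
            gen_stirling_nc \<alpha> (- (real n - real j * \<alpha> + \<alpha> - real (ns i))) (m + ns i - l) k)"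
    proof (cases "l \<le> m + ns i")
      case True
      then have N: "m + ns i - l = m - (l - ns i)" and le: "l - ns i \<le> m" using i by auto
      have binom: "real (m choose (l - ns i)) = fact m / (fact (l - ns i) * fact (m + ns i - l))"
        unfolding N by (rule binomial_fact[OF le])
      \<comment> \<open>For a single selected block the Stirling parameter contains j - 1.\<close>
      have \<gamma>: "real n - real j * \<alpha> + \<alpha> = real n - (real j - 1) * \<alpha>"
        by (simp add: algebra_simps)
      show ?thesis
        unfolding \<gamma> binom using gains[of "{i}"] i True by (simp add: Let_def mult_ac)
    next
      \<comment> \<open>The required gain exceeds m, so both the probability and the binomial
        coefficient are 0.\<close>
      case False
      then have "m choose (l - ns i) = 0" by simp
      then show ?thesis using False gains[of "{i}"] i by simp
    qed
  qed
  have obs_meas: "Measurable.pred M observed"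
    unfolding observed_def by (rule pred_restrict)
  have gain_meas: "Measurable.pred M (\<lambda>\<omega>. Mgain i \<omega> = c)" for i c
    unfolding Mgain_def by (rule pred_restrict)
  have obs_sets: "?obs \<in> sets M" using obs_meas by simp
  have "prob ?obs = V n j * block_weight \<alpha> ?P"
    unfolding observed_def block_weight_def using prob_restrict[OF n P] card_P by simp
  then have obs_pos: "prob ?obs > 0"
    using V block_weight_pos[OF alpha_less_1, of ?P] by simp
  then have obs_em: "emeasure M ?obs \<noteq> 0" "emeasure M ?obs \<noteq> \<infinity>"
    by (auto simp: emeasure_eq_measure)
  interpret U: prob_space ?U by (rule prob_space_uniform_measure[OF obs_em])
  have Ol_indicator: "real (Ol \<omega>) = (\<Sum>i\<in>?I. indicator {\<omega>. Mgain i \<omega> = l - ns i} \<omega>)" for \<omega>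
    unfolding Ol_def Ol_sum Mgain_def of_nat_sum by (intro sum.cong) (auto simp: indicator_def)
  have mean: "(\<integral>\<omega>. real (Ol \<omega>) \<partial>?U) =
      (\<Sum>i\<in>?I. \<P>(\<omega> in M. Mgain i \<omega> = l - ns i \<bar> observed \<omega>))"
  proof -
    \<comment> \<open>Intersecting with the space turns the level sets into measurable sets without
      changing the indicators there.\<close>
    have ind: "(indicator {\<omega>. Mgain i \<omega> = l - ns i} \<omega> :: real) =
        indicator {\<omega> \<in> space ?U. Mgain i \<omega> = l - ns i} \<omega>" if "\<omega> \<in> space ?U" for i \<omega>
      using that by (simp add: indicator_def)
    have sets: "{\<omega> \<in> space ?U. Mgain i \<omega> = l - ns i} \<in> sets ?U" for i
      using gain_meas[of i "l - ns i"] by simp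
    have "(\<integral>\<omega>. real (Ol \<omega>) \<partial>?U) =
        (\<integral>\<omega>. (\<Sum>i\<in>?I. indicator {\<omega> \<in> space ?U. Mgain i \<omega> = l - ns i} \<omega>) \<partial>?U)"
      unfolding Ol_indicator by (rule Bochner_Integration.integral_cong [OF refl]) (simp add: ind)
    also have "\<dots> = (\<Sum>i\<in>?I. \<integral>\<omega>. indicator {\<omega> \<in> space ?U. Mgain i \<omega> = l - ns i} \<omega> \<partial>?U)"
      using sets by (intro Bochner_Integration.integral_sum integrable_real_indicator)
        (auto simp: U.emeasure_eq_measure)
    also have "\<dots> = (\<Sum>i\<in>?I. \<P>(\<omega> in ?U. Mgain i \<omega> = l - ns i))"
      using sets by simp
    also have "\<dots> = (\<Sum>i\<in>?I. \<P>(\<omega> in M. Mgain i \<omega> = l - ns i \<bar> observed \<omega>))"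
      using measure_uniform_measure_eq_cond_prob[OF gain_meas obs_meas] by simp
    finally show ?thesis .
  qed
  have dist: "(\<lambda>r::nat.
          (- 1) ^ r * fact (r + y) / (fact y * fact r) * (1 / V n j) *
          (\<Sum>X | X \<subseteq> ?I \<and> card X = r + y \<and> r * l + y * l \<le> m + (\<Sum>i\<in>X. ns i).
             let N = m + (\<Sum>i\<in>X. ns i) - (r * l + y * l) in
             fact m * (\<Prod>i\<in>X. pochhammer (real (ns i) - \<alpha>) (l - ns i)) /
               ((\<Prod>i\<in>X. fact (l - ns i)) * fact N) *
             (\<Sum>k=0..N.
                V (n + m) (j + k) *
                gen_stirling_nc \<alpha>
                  (- (real n - (real j - real r - real y) * \<alpha> - (\<Sum>i\<in>X. real (ns i)))) N k)))
       sums \<P>(\<omega> in M. Ol \<omega> = y \<bar> observed \<omega>)" (is "(\<lambda>r. ?a r * _ * (\<Sum>X\<in>?S r. ?t r X)) sums _") for y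
  proof -
    let ?c = "\<lambda>X. \<P>(\<omega> in M. \<forall>i\<in>X. Mgain i \<omega> = l - ns i \<bar> observed \<omega>)"
    have inner: "1 / V n j * (\<Sum>X\<in>?S r. ?t r X) = (\<Sum>X | X \<subseteq> ?I \<and> card X = r + y. ?c X)" for r
    proof (subst sum_distrib_left, rule sum.mono_neutral_cong_left)
      show "finite {X. X \<subseteq> ?I \<and> card X = r + y}"
        by (rule finite_subset[of _ "Pow ?I"]) auto
      show "?S r \<subseteq> {X. X \<subseteq> ?I \<and> card X = r + y}" by blast
      show "\<forall>X\<in>{X. X \<subseteq> ?I \<and> card X = r + y} - ?S r. ?c X = 0"
        by (simp add: gains add_mult_distrib)
      fix X assume X: "X \<in> ?S r"
      then have "X \<subseteq> ?I" and card: "card X * l = r * l + y * l" "card X * l \<le> m + (\<Sum>i\<in>X. ns i)"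
        "real j - real (card X) = real j - real r - real y"
        by (simp_all add: add_mult_distrib)
      show "1 / V n j * ?t r X = ?c X"
        unfolding gains[OF \<open>X \<subseteq> ?I\<close>] using card(2) by (simp only: card(1,3) if_True)
    qed
    have cond_gains: "?c X =
        (\<Sum>Q\<in>?E. of_bool (\<forall>i\<in>X. old_block_gain n m (A i) Q = l - ns i) * d Q)" for X
      unfolding Mgain_def by (rule cond)
    \<comment> \<open>Inclusion-exclusion is applied inside the sum over \<open>Q\<close>;
      exchanging the finite sums then recovers the joint laws of the gains.\<close>
    have "\<P>(\<omega> in M. Ol \<omega> = y \<bar> observed \<omega>) =
        (\<Sum>Q\<in>?E. of_bool (card {i \<in> ?I. old_block_gain n m (A i) Q = l - ns i} = y) * d Q)"
      unfolding Ol_def Ol_card by (rule cond)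
    also have "\<dots> = (\<Sum>Q\<in>?E. \<Sum>r\<le>card ?I. \<Sum>X | X \<subseteq> ?I \<and> card X = r + y.
        ?a r * (of_bool (\<forall>i\<in>X. old_block_gain n m (A i) Q = l - ns i) * d Q))"
      unfolding of_bool_card_eq_alternating_sum[OF finI] sum_distrib_left sum_distrib_right mult.assoc ..
    also have "\<dots> = (\<Sum>r\<le>card ?I. \<Sum>X | X \<subseteq> ?I \<and> card X = r + y. \<Sum>Q\<in>?E.
        ?a r * (of_bool (\<forall>i\<in>X. old_block_gain n m (A i) Q = l - ns i) * d Q))"
      by (subst sum.swap) (intro sum.cong refl sum.swap)
    also have "\<dots> = (\<Sum>r\<le>card ?I. ?a r * (\<Sum>X | X \<subseteq> ?I \<and> card X = r + y. ?c X))"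
      unfolding cond_gains sum_distrib_left ..
    also have "\<dots> = (\<Sum>r\<le>card ?I. ?a r * (1 / V n j) * (\<Sum>X\<in>?S r. ?t r X))"
      unfolding inner[symmetric] mult.assoc ..
    finally have eq: "\<P>(\<omega> in M. Ol \<omega> = y \<bar> observed \<omega>) =
        (\<Sum>r\<le>card ?I. ?a r * (1 / V n j) * (\<Sum>X\<in>?S r. ?t r X))" .
    show ?thesis
      unfolding eq
    \<comment> \<open>For r beyond the number of candidate blocks there is no subset of size r + y,
      so the series is a finite sum.\<close>
    proof (rule sums_finite)
      fix r assume r: "r \<notin> {..card ?I}"
      have "card X \<noteq> r + y" if "X \<subseteq> ?I" for X
        using card_mono[OF finI that] r by auto
      then have "?S r = {}" by blast
      then show "?a r * (1 / V n j) * (\<Sum>X\<in>?S r. ?t r X) = 0"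
        by (simp only: sum.empty mult_zero_right)
    qed simp
  qed
  have bayes: "bayes_estimator M \<pi> n (\<lambda>\<omega>'. real (old_species n l (?R \<omega>'))) \<omega> = estimate"
    if \<omega>: "\<omega> \<in> space M" "observed \<omega>" for \<omega>
  proof -
    let ?f = "\<lambda>\<omega>'. real (old_species n l (?R \<omega>'))"
    have f_meas: "?f \<in> borel_measurable M"
      by (rule measurable_compose[OF measurable_restrict]) simp
    have "old_species n l (?R \<omega>') \<le> n + m" if "\<omega>' \<in> space M" for \<omega>'
    proof -
      have part: "partition_on {1..n + m} (?R \<omega>')"
        using restrict_extends[OF that, of n m] by (simp add: partition_extensions_def)
      have "old_species n l (?R \<omega>') \<le> card (?R \<omega>')"
        unfolding old_species_def
        by (rule card_mono[OF partition_on_finite_blocks(1)[OF part]]) blast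
      also have "\<dots> \<le> n + m"
        by (rule card_partition_on_le[OF part])
      finally show ?thesis .
    qed
    \<comment> \<open>The bound by the number of blocks gives integrability, as the conditional
      expectation requires.\<close>
    then have f_int: "integrable M ?f"
      using f_meas by (intro integrable_const_bound[of _ "real (n + m)"]) 
        (auto intro!: AE_I2 simp flip: of_nat_add)
    have obs_eq: "{\<omega>' \<in> space M. restrict_partition n (\<pi> \<omega>') = restrict_partition n (\<pi> \<omega>)} = ?obs"
      using \<omega>(2) by (simp add: observed_def)
    \<comment> \<open>Only on the observed event do the old species correspond to the enumeration
      \<open>A\<close>; the fibre integral needs no more.\<close>
    have Ol_f: "?f \<omega>' = real (Ol \<omega>')" if "\<omega>' \<in> ?obs" for \<omega>'
    proof -
      have "?R \<omega>' \<in> ?E" using restrict_extends[of \<omega>' n m] that by (simp add: observed_def)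
      then show ?thesis using old_species_eq_old_blocks_of_size[OF _ A] by (simp add: Ol_def)
    qed
    have "(\<integral>\<omega>'\<in>?obs. ?f \<omega>' \<partial>M) = (\<integral>\<omega>'\<in>?obs. real (Ol \<omega>') \<partial>M)"
      using obs_sets Ol_f by (intro set_lebesgue_integral_cong) auto
    also have "\<dots> = (\<integral>\<omega>'. (\<Sum>i\<in>?I. indicator {\<omega>' \<in> space M. Mgain i \<omega>' = l - ns i \<and> observed \<omega>'} \<omega>') \<partial>M)"
      unfolding set_lebesgue_integral_def Ol_indicator
      by (rule Bochner_Integration.integral_cong [OF refl]) (auto simp: indicator_def intro!: sum.neutral)
    also have "\<dots> = (\<Sum>i\<in>?I. \<integral>\<omega>'. indicator {\<omega>' \<in> space M. Mgain i \<omega>' = l - ns i \<and> observed \<omega>'} \<omega>' \<partial>M)"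
      using gain_meas obs_meas
      by (intro Bochner_Integration.integral_sum integrable_real_indicator) (auto simp: emeasure_eq_measure)
    also have "\<dots> = (\<Sum>i\<in>?I. \<P>(\<omega>' in M. Mgain i \<omega>' = l - ns i \<and> observed \<omega>'))"
      using gain_meas obs_meas by simp
    also have "\<dots> / prob ?obs = estimate"
      unfolding expected[symmetric] cond_prob_def sum_divide_distrib ..
    finally show ?thesis
      unfolding bayes_estimator_def
      using real_cond_exp_vimage_count_space[OF measurable_restrict f_int \<omega>(1), of n] obs_pos
      unfolding obs_eq by simp
  qed
  show ?thesis
    using dist mean expected bayes by (auto intro!: AE_I2)
qed

end
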